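(* Let $h,p>0$ and suppose $D$ is exponentially distributed with rate $\lambda>0$ (mean $\lambda^{-1}$). Let $\tau_{p,h}=\sqrt{\frac{h}{2p+h}}$ and $\gamma_{p,h}=(1-\tau_{p,h})\exp(\tau_{p,h})$. Then $C(\pi_{r_\infty})=\lambda^{-1}\big(\sqrt{h(2p+h)}-h\big)$, and for every integer $L\ge1$, $$\frac{C(\pi_{r_\infty})}{\mathrm{OPT}(L)}\ \le\ 1+\Big(\tau_{p,h}+(\tau_{p,h}^{-1}-1)\big(e(L+1)\big)^{-1}\Big)\Big((1-\gamma_{p,h})\log(1+ph^{-1})\Big)^{-1}\gamma_{p,h}^{L+1}.$$
   Context: Lost-sales inventory model. $\{D_t\}_{t\ge1}$ are i.i.d. demands distributed as $D$; $L\ge1$ is an integer lead time; $h>0$ and $p>0$ are the unit holding cost and the unit lost-sales penalty. At the start of period $t$ the state is the on-hand inventory $I_t\ge 0$ and the pipeline vector $\mathbf{x}_t=(x_{1,t},\dots,x_{L,t})\in[0,\infty)^L$, with initial conditions $I_1=0$, $\mathbf{x}_1=\mathbf{0}$. An admissible policy $\pi\in\Pi$ is a sequence of deterministic measurable functions $f^\pi_t:[0,\infty)^{L+1}\to[0,\infty)$, $t\ge1$; in period $t$ the quantity $x_{1,t}$ is delivered, the order $f^\pi_t(\mathbf{x}_t,I_t)$ is placed, and then $D_t$ is realized. The dynamics are $I_{t+1}=\max(0,I_t+x_{1,t}-D_t)$, $x_{i,t+1}=x_{i+1,t}$ for $1\le i\le L-1$, and $x_{L,t+1}=f^\pi_t(\mathbf{x}_t,I_t)$.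 The cost in period $t$ is $C^\pi_t=h(I_t+x_{1,t}-D_t)^++p(I_t+x_{1,t}-D_t)^-$, where $x^+=\max(x,0)$, $x^-=\max(-x,0)$. The long-run average cost is $C(\pi)=\limsup_{T\to\infty}\frac1T\sum_{t=1}^T\mathbb{E}[C^\pi_t]$, and $\mathrm{OPT}(L)=\inf_{\pi\in\Pi}C(\pi)$. Constant-order policies. For $r\in[0,\mathbb{E}[D])$, $\pi_r$ is the policy that orders $r$ in every period. It is well known that, independently of $L$, $$C(\pi_r)=h\,\mathbb{E}\Big[\sup_{j\ge0}\Big(jr-\sum_{i=1}^jD_i\Big)\Big]+p\,\mathbb{E}[D]-pr ,$$ which is finite and convex in $r$ on $[0,\mathbb{E}[D])$ and tends to $\infty$ as $r\uparrow\mathbb{E}[D]$ (set it to $+\infty$ at $r=\mathbb{E}[D]$). Empty sums equal $0$. $r_\infty$ denotes the infimum of the set of minimizers of $r\mapsto C(\pi_r)$ over $[0,\mathbb{E}[D]]$; it is itself a minimizer and $r_\infty<\mathbb{E}[D]$. $\log$ is the natural logarithm and $e$ is Euler's number. *)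

theory Defs
  imports "HOL-Probability.Probability"
begin

text \<open>
  A state is a pair \<open>(x, I)\<close> of a pipeline vector \<open>x \<in> [0,\<infinity>)\<^sup>L\<close>, represented as an extensional
  function on \<open>{1..L}\<close>, and the on-hand inventory \<open>I \<ge> 0\<close>.
\<close>

type_synonym state = "(nat \<Rightarrow> real) \<times> real"

type_synonym policy = "nat \<Rightarrow> state \<Rightarrow> real"

abbreviation borel_nonneg :: "real measure" where
  "borel_nonneg \<equiv> restrict_space borel {0..}"

text \<open>The Borel space \<open>[0,\<infinity>)\<^sup>L\<^sup>+\<^sup>1\<close>.\<close>

definition state_space :: "nat \<Rightarrow> state measure" where
  "state_space L = (\<Pi>\<^sub>M i\<in>{1..L}. borel_nonneg) \<Otimes>\<^sub>M borel_nonneg"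

definition policies :: "nat \<Rightarrow> policy set" where
  "policies L = {f. \<forall>t\<ge>1. f t \<in> measurable (state_space L) borel_nonneg}"

definition init_state :: "nat \<Rightarrow> state" where
  "init_state L = ((\<lambda>i\<in>{1..L}. 0), 0)"

definition next_state :: "nat \<Rightarrow> (state \<Rightarrow> real) \<Rightarrow> real \<Rightarrow> state \<Rightarrow> state" where
  "next_state L g d s =
     ((\<lambda>i\<in>{1..L}. if i < L then fst s (i + 1) else g s), max 0 (snd s + fst s 1 - d))"

text \<open>
  \<open>state_at L f d t\<close> is the state at the start of period \<open>t \<ge> 1\<close> along the demand path \<open>d\<close>.
  Periods are numbered from 1; the value at \<open>t = 0\<close> is a dummy.
\<close>

primrec state_at :: "nat \<Rightarrow> policy \<Rightarrow> (nat \<Rightarrow> real) \<Rightarrow> nat \<Rightarrow> state" where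
  "state_at L f d 0 = init_state L"
| "state_at L f d (Suc t) =
     (if t = 0 then init_state L else next_state L (f t) (d t) (state_at L f d t))"

definition period_cost ::
  "real \<Rightarrow> real \<Rightarrow> nat \<Rightarrow> policy \<Rightarrow> (nat \<Rightarrow> real) \<Rightarrow> nat \<Rightarrow> real" where
  "period_cost h p L f d t =
     (let (x, I) = state_at L f d t; y = I + x 1 - d t
      in h * max y 0 + p * max (- y) 0)"

text \<open>
  Period costs are nonnegative, so their expectations are taken in \<open>[0,\<infinity>]\<close>; no integrability
  condition is imposed on policies.
\<close>

definition avg_cost ::
  "'w measure \<Rightarrow> (nat \<Rightarrow> 'w \<Rightarrow> real) \<Rightarrow> real \<Rightarrow> real \<Rightarrow> nat \<Rightarrow> policy \<Rightarrow> ennreal" where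
  "avg_cost M D h p L f =
     limsup (\<lambda>T. (\<Sum>t=1..T. \<integral>\<^sup>+ w. ennreal (period_cost h p L f (\<lambda>s. D s w) t) \<partial>M) / of_nat T)"

definition OPT ::
  "'w measure \<Rightarrow> (nat \<Rightarrow> 'w \<Rightarrow> real) \<Rightarrow> real \<Rightarrow> real \<Rightarrow> nat \<Rightarrow> ennreal" where
  "OPT M D h p L = (INF f\<in>policies L. avg_cost M D h p L f)"

definition const_policy :: "real \<Rightarrow> policy" where
  "const_policy r = (\<lambda>t s. r)"

text \<open>
  The cost of the constant-order policy as a function of \<open>r \<in> [0, E D]\<close>, with the convention that
  it is infinite at \<open>r = E D\<close>.
\<close>

definition const_cost ::
  "'w measure \<Rightarrow> (nat \<Rightarrow> 'w \<Rightarrow> real) \<Rightarrow> real \<Rightarrow> real \<Rightarrow> nat \<Rightarrow> real \<Rightarrow> ennreal" where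
  "const_cost M D h p L r =
     (if r < integral\<^sup>L M (D 1) then avg_cost M D h p L (const_policy r) else \<infinity>)"

definition r_inf ::
  "'w measure \<Rightarrow> (nat \<Rightarrow> 'w \<Rightarrow> real) \<Rightarrow> real \<Rightarrow> real \<Rightarrow> nat \<Rightarrow> real" where
  "r_inf M D h p L =
     Inf {r. is_arg_min (const_cost M D h p L) (\<lambda>r. r \<in> {0..integral\<^sup>L M (D 1)}) r}"

definition tau :: "real \<Rightarrow> real \<Rightarrow> real" where
  "tau p h = sqrt (h / (2 * p + h))"

definition gam :: "real \<Rightarrow> real \<Rightarrow> real" where
  "gam p h = (1 - tau p h) * exp (tau p h)"

end

theory Submission
  imports Defs
begin

text \<open>
  Write \<open>G n\<close> and \<open>Q n\<close> for the expected maximum of the random walk with steps \<open>r - D\<close> over \<open>n\<close>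
  steps and for the expected time at which it is attained. A delivery was ordered \<open>L\<close> periods
  before it arrives, so in a window of \<open>L\<close> periods deliveries and demands are independent, and
  the argmax of the constant-rate walk, used as a subgradient for the stock, shows that no policy
  costs less than \<open>h * (G L + Q L * (1 / lam - r))\<close> whenever \<open>h * Q L \<le> p\<close>. The constant-order
  policy has the same cost with \<open>L\<close> replaced by infinity, where \<open>h * Q = p\<close> is the stationarity
  condition for the optimal \<open>r\<close>. By Spitzer's identity the difference is a sum over \<open>k > L\<close> of
  moments of the positive part of the walk at time \<open>k\<close>, which Chernoff's bound controls by
  \<open>gam ^ k\<close>. For exponential demands the limit of \<open>G\<close> is explicit (Pollaczek--Khinchine), and the
  newsvendor cost \<open>h / lam * ln (1 + p / h)\<close> bounds the denominator from below.
\<close>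

section \<open>Waiting times and busy periods\<close>

text \<open>The obstacle is that orders react to past demand, so the stock under a general policy
  has no tractable law. The lower bound sees a policy only through its expected deliveries: the
  subgradient inequality is linear in them, and conservation of stock shows that deliveries fall
  short of mean demand by at most the expected lost sales. Lost sales can therefore reduce the
  holding cost by at most h * Q L per unit, and the condition h * Q L <= p says that the penalty
  outweighs this saving. Since Q L increases to the r-derivative of the limit of G, the rate
  minimising the constant-order cost meets the condition for every L, and the bound becomes tight as
  L grows. The constant \<open>gam p h\<close> is the minimum over \<theta> of the moment generating
  function of r - D at that rate. The factor e comes from e x <= exp x, and L + 1 from the weight 1
  / k in Spitzer's identity. The limit of Q is obtained by differentiating the limit of G, so the
  law of busy periods is never computed.\<close>

primrec waiting :: "(nat \<Rightarrow> real) \<Rightarrow> nat \<Rightarrow> real" where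
  "waiting z 0 = 0"
| "waiting z (Suc n) = max 0 (waiting z n + z n)"

text \<open>\<open>waiting z n\<close> is the largest suffix sum of the first \<open>n\<close>
  terms, the empty suffix included. \<open>busy z n\<close> is the length of the shortest suffix
  attaining it, that is, the time since \<open>waiting\<close> was last 0.\<close>

primrec busy :: "(nat \<Rightarrow> real) \<Rightarrow> nat \<Rightarrow> nat" where
  "busy z 0 = 0"
| "busy z (Suc n) = (if waiting z n + z n > 0 then Suc (busy z n) else 0)"

lemma waiting_nonneg [simp]: "0 \<le> waiting z n"
  by (cases n) auto

lemma busy_le: "busy z n \<le> n"
  by (induction n) auto

lemma waiting_busy_cong:
  assumes "\<And>i. i < n \<Longrightarrow> z i = z' i"
  shows "waiting z n = waiting z' n \<and> busy z n = busy z' n"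
  using assms by (induction n) auto

lemma waiting_le: "(\<And>i. i < n \<Longrightarrow> z i \<le> r) \<Longrightarrow> 0 \<le> r \<Longrightarrow> waiting z n \<le> n * r"
proof (induction n)
  case (Suc n)
  then have "waiting z n \<le> n * r" "z n \<le> r" by auto
  then have "waiting z n + z n \<le> Suc n * r" by (simp add: algebra_simps)
  moreover have "0 \<le> Suc n * r" using Suc.prems by simp
  ultimately show ?case by simp
qed simp

text \<open>Among the suffixes of the first n + 1 terms only the whole one contains the oldest term.
  The definition adds the newest term, this recursion the oldest; Spitzer's identity comes from
  playing one against the other.\<close>

lemma waiting_Suc_shift: "waiting z (Suc n) = max (waiting (\<lambda>i. z (Suc i)) n) (\<Sum>i<Suc n. z i)"
proof (induction n)
  case (Suc n)
  have "waiting z (Suc (Suc n)) = max 0 (max (waiting (\<lambda>i. z (Suc i)) n) (\<Sum>i<Suc n. z i) + z (Suc n))"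
    unfolding Suc.IH[symmetric] by simp
  then show ?case by (auto simp: max_def)
qed simp

lemma busy_Suc_shift:
  "busy z (Suc n) = (if (\<Sum>i<Suc n. z i) > waiting (\<lambda>i. z (Suc i)) n then Suc n else busy (\<lambda>i. z (Suc i)) n)"
proof (induction n)
  case (Suc n)
  have "busy z (Suc (Suc n)) =
      (if waiting z (Suc n) + z (Suc n) > 0 then Suc (busy z (Suc n)) else 0)"
    by simp
  then show ?case
    unfolding Suc.IH waiting_Suc_shift[of z n] by (auto simp: max_def not_less)
qed simp

text \<open>A positive total makes the maximum positive, so the recursion is not cut off at 0. A
  nonpositive total never beats the empty suffix, so the oldest term can be discarded. The
  indicators allow expectations to be taken term by term.\<close>

lemma waiting_Suc_cases:
  defines "S \<equiv> \<lambda>z n. \<Sum>i<Suc n. z i :: real"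
  shows "waiting z (Suc n) = indicator {0<..} (S z n) * z n + (indicator {0<..} (S z n) * waiting z n
      + indicator {..0} (S z n) * waiting (\<lambda>i. z (Suc i)) n)"
proof (cases "S z n > 0")
  case True
  then have "waiting z (Suc n) > 0" unfolding waiting_Suc_shift S_def by simp
  then show ?thesis using True by (auto simp: indicator_def)
next
  case False
  then show ?thesis unfolding waiting_Suc_shift S_def
    by (auto simp: indicator_def max_def) (metis dual_order.trans dual_order.antisym waiting_nonneg not_less)
qed

lemma busy_Suc_cases:
  defines "S \<equiv> \<lambda>z n. \<Sum>i<Suc n. z i :: real"
  shows "real (busy z (Suc n)) = indicator {0<..} (S z n) + (indicator {0<..} (S z n) * real (busy z n)
      + indicator {..0} (S z n) * real (busy (\<lambda>i. z (Suc i)) n))"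
proof (cases "S z n > 0")
  case True
  then have "waiting z (Suc n) > 0" unfolding waiting_Suc_shift S_def by simp
  then show ?thesis using True by (auto simp: indicator_def)
next
  case False
  then have "\<not> S z n > waiting (\<lambda>i. z (Suc i)) n"
    using waiting_nonneg[of "\<lambda>i. z (Suc i)" n] by linarith
  then show ?thesis using False unfolding busy_Suc_shift S_def by (auto simp: indicator_def)
qed

text \<open>As a maximum of suffix sums, \<open>waiting\<close> is convex in the inputs, and the
  maximising suffix at constant input \<open>r\<close> yields a subgradient there: coordinate 1 on
  the last \<open>busy\<close> indices, 0 elsewhere.\<close>

lemma waiting_subgradient:
  "waiting (\<lambda>i. r - d i) n + (\<Sum>i<n. if n \<le> i + busy (\<lambda>i. r - d i) n then x i - r else 0)
     \<le> waiting (\<lambda>i. x i - d i) n"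
proof (induction n)
  case (Suc n)
  show ?case
  proof (cases "waiting (\<lambda>i. r - d i) n + (r - d n) > 0")
    case True
    then show ?thesis using Suc by simp
  next
    case False
    have "(\<Sum>i<Suc n. if Suc n \<le> i + busy (\<lambda>i. r - d i) (Suc n) then x i - r else 0) = 0"
      using False by (intro sum.neutral) auto
    then show ?thesis using False by simp
  qed
qed simp

lemma busy_eq_sum: "real (busy z n) = (\<Sum>i<n. if n \<le> i + busy z n then 1 else 0)"
proof -
  have "{i. i < n \<and> n \<le> i + busy z n} = {n - busy z n..<n}" by auto
  then show ?thesis using busy_le[of z n] by (simp add: sum.If_cases Int_def)
qed

lemma waiting_subgradient_const:
  "waiting (\<lambda>i. r - d i) n + real (busy (\<lambda>i. r - d i) n) * (r' - r) \<le> waiting (\<lambda>i. r' - d i) n"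
proof -
  have "(\<Sum>i<n. if n \<le> i + busy (\<lambda>i. r - d i) n then r' - r else 0)
      = real (busy (\<lambda>i. r - d i) n) * (r' - r)"
    by (subst busy_eq_sum, subst sum_distrib_right) (auto intro!: sum.cong)
  then show ?thesis
    using waiting_subgradient[of r d n "\<lambda>_. r'"] by simp
qed

lemma measurable_waiting [measurable]:
  assumes "\<And>i. i < n \<Longrightarrow> (\<lambda>w. z w i) \<in> borel_measurable M"
  shows "(\<lambda>w. waiting (z w) n) \<in> borel_measurable M"
  using assms by (induction n) auto

lemma measurable_busy [measurable]:
  assumes "\<And>i. i < n \<Longrightarrow> (\<lambda>w. z w i) \<in> borel_measurable M"
  shows "(\<lambda>w. busy (z w) n) \<in> measurable M (count_space UNIV)"
  using assms
proof (induction n)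
  case (Suc n)
  then have [measurable]: "(\<lambda>w. busy (z w) n) \<in> measurable M (count_space UNIV)"
    "(\<lambda>w. z w n) \<in> borel_measurable M" by auto
  have [measurable]: "(\<lambda>w. waiting (z w) n) \<in> borel_measurable M"
    using Suc.prems by (intro measurable_waiting) auto
  show ?case by simp
qed simp

section \<open>Elementary estimates\<close>

lemma exp_ge_linear: "exp 1 * x \<le> exp (x::real)"
proof -
  have "exp x = exp 1 * exp (x - 1)" by (simp add: exp_add[symmetric])
  moreover have "exp (x - 1) \<ge> x" using exp_ge_add_one_self[of "x - 1"] by simp
  ultimately show ?thesis by simp
qed

lemma exp_ge_square: "0 \<le> x \<Longrightarrow> x\<^sup>2 \<le> 2 * exp (x::real)"
  using exp_lower_Taylor_quadratic[of x] by simp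

lemma geometric_tail_bound:
  fixes a :: "nat \<Rightarrow> real"
  assumes lim: "a \<longlonglongrightarrow> l" and g: "0 \<le> g" "g < 1" and c: "0 \<le> c"
    and step: "\<And>k. n \<le> k \<Longrightarrow> a (Suc k) \<le> a k + c * g ^ Suc k"
  shows "l \<le> a n + c * (g ^ Suc n / (1 - g))"
proof -
  \<comment> \<open>The factor \<open>1 - g ^ m\<close> makes the right-hand side the exact partial
    geometric sum, so that the induction closes.\<close>
  have *: "a (n + m) \<le> a n + c * (g ^ Suc n / (1 - g)) * (1 - g ^ m)" for m
  proof (induction m)
    case (Suc m)
    have "c * (g ^ Suc n / (1 - g)) * (1 - g ^ m) + c * g ^ Suc (n + m)
        = c * (g ^ Suc n / (1 - g)) * (1 - g ^ Suc m)"
      using g by (simp add: field_simps power_add)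
    then show ?case using Suc step[of "n + m"] by simp
  qed simp
  have "a (n + m) \<le> a n + c * (g ^ Suc n / (1 - g))" for m
  proof -
    have "c * (g ^ Suc n / (1 - g)) * (1 - g ^ m) \<le> c * (g ^ Suc n / (1 - g)) * 1"
      using g c by (intro mult_left_mono) auto
    then show ?thesis using *[of m] by simp
  qed
  then have "\<exists>N. \<forall>m\<ge>N. a m \<le> a n + c * (g ^ Suc n / (1 - g))"
    by (metis le_iff_add)
  then show ?thesis using lim by (intro LIMSEQ_le_const2)
qed

section \<open>Independent exponential demands\<close>

text \<open>Fubini with both integrals kept over \<open>M\<close>: once \<open>X\<close> is frozen,
  facts about a single demand apply to the inner integral.\<close>

lemma (in prob_space) nn_integral_indep_var:
  fixes f :: "real \<times> real \<Rightarrow> ennreal"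
  assumes ind: "indep_var borel X borel Y" and f: "f \<in> borel_measurable (borel \<Otimes>\<^sub>M borel)"
  shows "(\<integral>\<^sup>+w. f (X w, Y w) \<partial>M) = (\<integral>\<^sup>+w. (\<integral>\<^sup>+w'. f (X w, Y w') \<partial>M) \<partial>M)"
proof -
  have [measurable]: "X \<in> borel_measurable M" "Y \<in> borel_measurable M"
    using ind by (auto dest: indep_var_rv1 indep_var_rv2)
  note [measurable] = f
  interpret Y: prob_space "distr M borel Y" by (rule prob_space_distr) simp
  have f': "f \<in> borel_measurable (distr M borel X \<Otimes>\<^sub>M distr M borel Y)"
    by (subst measurable_cong_sets[OF sets_pair_measure_cong[OF sets_distr sets_distr] refl]) (rule f)
  have "(\<integral>\<^sup>+w. f (X w, Y w) \<partial>M) = (\<integral>\<^sup>+z. f z \<partial>distr M (borel \<Otimes>\<^sub>M borel) (\<lambda>w. (X w, Y w)))"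
    by (simp add: nn_integral_distr)
  also have "\<dots> = (\<integral>\<^sup>+z. f z \<partial>(distr M borel X \<Otimes>\<^sub>M distr M borel Y))"
    using ind indep_var_distribution_eq[of borel X borel Y] by simp
  also have "\<dots> = (\<integral>\<^sup>+x. \<integral>\<^sup>+y. f (x, y) \<partial>distr M borel Y \<partial>distr M borel X)"
    by (rule Y.nn_integral_fst[OF f', symmetric])
  also have "\<dots> = (\<integral>\<^sup>+w. (\<integral>\<^sup>+w'. f (X w, Y w') \<partial>M) \<partial>M)"
    by (subst nn_integral_distr, simp, measurable) (simp add: nn_integral_distr)
  finally show ?thesis .
qed

locale exp_demand = prob_space M for M :: "'w measure" +
  fixes D :: "nat \<Rightarrow> 'w \<Rightarrow> real" and lam :: real
  assumes lam_pos: "lam > 0"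
    and indep: "indep_vars (\<lambda>_. borel) D {1..}"
    and D_dist: "\<And>t. t \<ge> 1 \<Longrightarrow> distributed M lborel (D t) (\<lambda>x. ennreal (exponential_density lam x))"
begin

lemma D_measurable: "t \<ge> 1 \<Longrightarrow> D t \<in> borel_measurable M"
  using distributed_measurable[OF D_dist] by simp

lemma D_Suc_measurable [measurable]: "D (Suc t) \<in> borel_measurable M"
  by (rule D_measurable) simp

lemma D_distr: "t \<ge> 1 \<Longrightarrow> distr M borel (D t) = density lborel (\<lambda>x. ennreal (exponential_density lam x))"
  using distributed_distr_eq_density[OF D_dist, of t] distr_cong[OF refl sets_lborel, of M "D t" "D t"]
  by simp

text \<open>Any two injective selections of \<open>n\<close> demands have the same joint law.
  Allowing arbitrary injections covers shifts in time, rotations and transpositions at once.\<close>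

lemma expectation_iid:
  fixes \<Phi> :: "(nat \<Rightarrow> real) \<Rightarrow> real"
  assumes s: "inj_on s {..<n}" "s ` {..<n} \<subseteq> {1..}" "inj_on t {..<n}" "t ` {..<n} \<subseteq> {1..}"
    and \<Phi>: "\<Phi> \<in> borel_measurable (\<Pi>\<^sub>M i\<in>{..<n}. borel)" "\<And>d. \<Phi> (restrict d {..<n}) = \<Phi> d"
  shows "expectation (\<lambda>w. \<Phi> (\<lambda>i. D (s i) w)) = expectation (\<lambda>w. \<Phi> (\<lambda>i. D (t i) w))"
proof (cases "n = 0")
  case True
  then have "\<Phi> d = \<Phi> d'" for d d'
    using \<Phi>(2)[of d] \<Phi>(2)[of d'] by (simp add: restrict_def)
  then show ?thesis by metis
next
  case False
  let ?P = "density lborel (\<lambda>x. ennreal (exponential_density lam x))"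
  have *: "expectation (\<lambda>w. \<Phi> (\<lambda>i. D (s i) w)) =
      (\<integral>d. \<Phi> d \<partial>(\<Pi>\<^sub>M i\<in>{..<n}. ?P))"
    if s: "inj_on s {..<n}" "s ` {..<n} \<subseteq> {1..}" for s
  proof -
    have rv: "D (s i) \<in> borel_measurable M" if "i \<in> {..<n}" for i
      using that s by (intro D_measurable) auto
    have "distr M (\<Pi>\<^sub>M i\<in>{..<n}. borel) (\<lambda>w. \<lambda>i\<in>{..<n}. D (s i) w)
        = distr (distr M (\<Pi>\<^sub>M i\<in>{1..}. borel) (\<lambda>w. \<lambda>i\<in>{1..}. D i w))
            (\<Pi>\<^sub>M i\<in>{..<n}. borel) (\<lambda>d. \<lambda>i\<in>{..<n}. d (s i))"
      using s D_measurable
      by (subst distr_distr)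
         (auto simp: comp_def image_subset_iff Pi_iff intro!: measurable_restrict distr_cong)
    also have "distr M (\<Pi>\<^sub>M i\<in>{1..}. borel) (\<lambda>w. \<lambda>i\<in>{1..}. D i w) = (\<Pi>\<^sub>M i\<in>{1..}. ?P)"
      using indep D_measurable
      by (subst (asm) indep_vars_iff_distr_eq_PiM') (auto intro!: PiM_cong D_distr)
    also have "distr (\<Pi>\<^sub>M i\<in>{1..}. ?P) (\<Pi>\<^sub>M i\<in>{..<n}. borel) (\<lambda>d. \<lambda>i\<in>{..<n}. d (s i))
        = distr (\<Pi>\<^sub>M i\<in>{1..}. ?P) (\<Pi>\<^sub>M i\<in>{..<n}. ?P) (\<lambda>d. \<lambda>i\<in>{..<n}. d (s i))"
      by (intro distr_cong sets_PiM_cong) auto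
    also have "\<dots> = (\<Pi>\<^sub>M i\<in>{..<n}. ?P)"
      using distr_PiM_reindex[of "{1..}" "\<lambda>_. ?P" s "{..<n}"] s
        prob_space_exponential_density[OF lam_pos] by auto
    finally have "distr M (\<Pi>\<^sub>M i\<in>{..<n}. borel) (\<lambda>w. \<lambda>i\<in>{..<n}. D (s i) w) = \<dots>" .
    moreover have "expectation (\<lambda>w. \<Phi> (\<lambda>i\<in>{..<n}. D (s i) w)) =
        (\<integral>d. \<Phi> d \<partial>distr M (\<Pi>\<^sub>M i\<in>{..<n}. borel) (\<lambda>w. \<lambda>i\<in>{..<n}. D (s i) w))"
      using rv \<Phi>(1) by (intro integral_distr[symmetric] measurable_restrict) auto
    ultimately show ?thesis using \<Phi>(2)[of "\<lambda>i. D (s i) _"] by simp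
  qed
  show ?thesis using *[OF s(1,2)] *[OF s(3,4)] by simp
qed

lemma indep_blocks:
  assumes AB: "A \<inter> B = {}" "A \<subseteq> {1..}" "B \<subseteq> {1..}"
    and F: "F \<in> measurable (\<Pi>\<^sub>M i\<in>A. borel) N1" "\<And>d. F (restrict d A) = F d"
    and G: "G \<in> measurable (\<Pi>\<^sub>M i\<in>B. borel) N2" "\<And>d. G (restrict d B) = G d"
  shows "indep_var N1 (\<lambda>w. F (\<lambda>s. D s w)) N2 (\<lambda>w. G (\<lambda>s. D s w))"
  using indep_var_compose[OF indep_var_restrict[OF indep AB] F(1) G(1)]
  by (simp add: comp_def F(2) G(2))

lemma indep_from_past:
  assumes "A \<subseteq> {1..}" "t \<ge> 1" "t \<notin> A"
    and F: "F \<in> measurable (\<Pi>\<^sub>M i\<in>A. borel) N1" "\<And>d. F (restrict d A) = F d"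
  shows "indep_var N1 (\<lambda>w. F (\<lambda>s. D s w)) borel (D t)"
  using assms by (intro indep_blocks[where A=A and B="{t}" and G="\<lambda>d. d t"]) (auto simp del: restrict_apply, simp)

lemma D_nonneg: "AE w in M. \<forall>i. D (Suc i) w \<ge> 0"
proof (subst AE_all_countable, rule allI)
  fix i
  show "AE w in M. D (Suc i) w \<ge> 0"
    by (subst distributed_AE2[OF D_dist]) (auto simp: exponential_density_def)
qed

lemma nn_integral_D:
  "t \<ge> 1 \<Longrightarrow> g \<in> borel_measurable borel \<Longrightarrow>
    (\<integral>\<^sup>+w. g (D t w) \<partial>M) = (\<integral>\<^sup>+x. ennreal (exponential_density lam x) * g x \<partial>lborel)"
  using distributed_nn_integral[OF D_dist] by simp

lemma integrable_D_power: "t \<ge> 1 \<Longrightarrow> integrable M (\<lambda>w. D t w ^ k)"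
  using erlang_ith_moment_integrable[OF lam_pos D_dist] by simp

lemma expectation_D: "t \<ge> 1 \<Longrightarrow> expectation (D t) = 1 / lam"
  using exponential_distributed_expectation[OF lam_pos D_dist] by simp

lemma expectation_D_square: "t \<ge> 1 \<Longrightarrow> expectation (\<lambda>w. (D t w)\<^sup>2) = 2 / lam\<^sup>2"
  using erlang_ith_moment[OF lam_pos D_dist, of t 2] by simp

lemma integrable_D: "t \<ge> 1 \<Longrightarrow> integrable M (D t)"
  using integrable_D_power[of t 1] by simp

text \<open>By memorylessness, the excess of \<open>D t\<close> over \<open>y\<close> is exponential again, with mass \<open>exp (- lam y)\<close>.\<close>

lemma nn_integral_excess:
  assumes t: "t \<ge> 1" and y: "y \<ge> 0" and k: "k \<noteq> 0"
  shows "(\<integral>\<^sup>+w. ennreal ((max 0 (D t w - y)) ^ k) \<partial>M) = ennreal (exp (- lam * y) * (fact k / lam ^ k))"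
proof -
  have eq: "exponential_density lam (y + x) * max 0 x ^ k
      = exp (- lam * y) * (erlang_density 0 lam x * x ^ k)" for x
    using y k by (auto simp: erlang_density_def exponential_density_def max_def algebra_simps exp_add
        exp_diff exp_minus field_simps)
  have "(\<integral>\<^sup>+w. ennreal ((max 0 (D t w - y)) ^ k) \<partial>M)
      = (\<integral>\<^sup>+x. ennreal (exponential_density lam x * max 0 (x - y) ^ k) \<partial>lborel)"
    using lam_pos by (subst nn_integral_D[OF t]) (auto simp: ennreal_mult' exponential_density_nonneg)
  also have "\<dots> = (\<integral>\<^sup>+x. ennreal (exponential_density lam (y + x) * max 0 x ^ k) \<partial>lborel)"
    by (subst nn_integral_real_affine[where c=1 and t=y]) auto
  also have "\<dots> = (\<integral>\<^sup>+x. ennreal (exp (- lam * y)) * ennreal (erlang_density 0 lam x * x ^ k) \<partial>lborel)"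
    unfolding eq by (intro nn_integral_cong) (auto intro!: ennreal_mult')
  also have "\<dots> = ennreal (exp (- lam * y)) * (\<integral>\<^sup>+x. ennreal (erlang_density 0 lam x * x ^ k) \<partial>lborel)"
    by (rule nn_integral_cmult) simp
  also have "\<dots> = ennreal (exp (- lam * y) * (fact k / lam ^ k))"
    using nn_integral_erlang_ith_moment[OF lam_pos, of 0 k]
    by (simp only: ennreal_mult' exp_ge_zero) simp
  finally show ?thesis .
qed

lemma nn_integral_exp_D:
  assumes t: "t \<ge> 1" and \<theta>: "\<theta> \<ge> 0"
  shows "(\<integral>\<^sup>+w. ennreal (exp (- \<theta> * D t w)) \<partial>M) = ennreal (lam / (lam + \<theta>))"
proof -
  \<comment> \<open>Exponential tilting: the weight turns the density of rate \<open>lam\<close>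
    into a multiple of the density of rate \<open>lam + \<theta>\<close>.\<close>
  have eq: "exponential_density lam x * exp (- \<theta> * x)
      = lam / (lam + \<theta>) * (erlang_density 0 (lam + \<theta>) x * x ^ 0)" for x
    using lam_pos \<theta> by (auto simp: erlang_density_def exponential_density_def field_simps exp_add[symmetric])
  have "(\<integral>\<^sup>+w. ennreal (exp (- \<theta> * D t w)) \<partial>M)
      = (\<integral>\<^sup>+x. ennreal (exponential_density lam x * exp (- \<theta> * x)) \<partial>lborel)"
    using lam_pos by (subst nn_integral_D[OF t]) (auto simp: ennreal_mult' exponential_density_nonneg)
  also have "\<dots> = (\<integral>\<^sup>+x. ennreal (lam / (lam + \<theta>)) * ennreal (erlang_density 0 (lam + \<theta>) x * x ^ 0) \<partial>lborel)"
    unfolding eq using lam_pos \<theta> by (intro nn_integral_cong ennreal_mult') auto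
  also have "\<dots> = ennreal (lam / (lam + \<theta>)) * (\<integral>\<^sup>+x. ennreal (erlang_density 0 (lam + \<theta>) x * x ^ 0) \<partial>lborel)"
    by (rule nn_integral_cmult) simp
  also have "\<dots> = ennreal (lam / (lam + \<theta>))"
    using nn_integral_erlang_ith_moment[of "lam + \<theta>" 0 0] lam_pos \<theta> by simp
  finally show ?thesis .
qed

lemma expectation_exp_D:
  assumes t: "t \<ge> 1" and \<theta>: "\<theta> \<ge> 0"
  shows "integrable M (\<lambda>w. exp (- \<theta> * D t w))" "expectation (\<lambda>w. exp (- \<theta> * D t w)) = lam / (lam + \<theta>)"
  using nn_integral_exp_D[OF assms] lam_pos \<theta> D_measurable[OF t]
  by (auto intro: integrableI_nn_integral_finite integral_eq_nn_integral simp: integral_eq_nn_integral)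

lemma expectation_excess:
  assumes t: "t \<ge> 1" and y: "y \<ge> 0"
  shows "integrable M (\<lambda>w. max 0 (D t w - y))" "expectation (\<lambda>w. max 0 (D t w - y)) = exp (- lam * y) / lam"
  using nn_integral_excess[OF assms, of 1] lam_pos D_measurable[OF t]
  by (auto intro: integrableI_nn_integral_finite simp: integral_eq_nn_integral)

text \<open>The expected cost is h y - h / lam + (h + p) exp (- lam y) / lam, convex in y. Bounding
  the exponential by its tangent at the minimiser \<open>z\<close> leaves exactly h z.\<close>

lemma nn_integral_newsvendor:
  assumes t: "t \<ge> 1" and y: "y \<ge> 0" and h: "h > 0" and p: "p > 0"
  shows "ennreal (h / lam * ln (1 + p / h))
    \<le> (\<integral>\<^sup>+w. ennreal (h * max (y - D t w) 0 + p * max (- (y - D t w)) 0) \<partial>M)"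
proof -
  \<comment> \<open>The critical fractile: demand exceeds \<open>z\<close> with probability h / (h +
    p).\<close>
  define z where "z = ln (1 + p / h) / lam"
  have ez: "exp (- lam * z) = h / (h + p)"
    using lam_pos h p by (simp add: z_def exp_minus field_simps)
  have eq: "h * max (y - D t w) 0 + p * max (- (y - D t w)) 0
      = h * y - h * D t w + (h + p) * max 0 (D t w - y)" for w
    by (auto simp: max_def algebra_simps)
  have int: "integrable M (\<lambda>w. h * y - h * D t w + (h + p) * max 0 (D t w - y))"
    using expectation_excess(1)[OF t y] integrable_D[OF t] by auto
  have "h * (1 + (- lam * (y - z))) \<le> h * exp (- lam * (y - z))"
    using exp_ge_add_one_self[of "- lam * (y - z)"] h by (intro mult_left_mono) auto
  also have "h * exp (- lam * (y - z)) = (h + p) * exp (- lam * y)"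
  proof -
    have "exp (- lam * y) = exp (- lam * (y - z)) * exp (- lam * z)"
      by (simp add: exp_add[symmetric] algebra_simps)
    then show ?thesis unfolding ez using h p by (simp add: field_simps)
  qed
  finally have "h / lam * (1 + (- lam * (y - z))) \<le> (h + p) * (exp (- lam * y) / lam)"
    using lam_pos divide_right_mono[of _ _ lam] by fastforce
  moreover have "h / lam * (1 + (- lam * (y - z))) = h / lam - h * y + h * z"
    using lam_pos by (simp add: field_simps)
  ultimately have "h * z \<le> h * y - h * (1 / lam) + (h + p) * (exp (- lam * y) / lam)"
    by (simp add: field_simps)
  also have "\<dots> = expectation (\<lambda>w. h * y - h * D t w + (h + p) * max 0 (D t w - y))"
    using expectation_excess[OF t y] integrable_D[OF t] expectation_D[OF t]
    by (simp add: prob_space)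
  finally have "ennreal (h * z) \<le> ennreal \<dots>" by (rule ennreal_leI)
  also have "\<dots> = (\<integral>\<^sup>+w. ennreal (h * y - h * D t w + (h + p) * max 0 (D t w - y)) \<partial>M)"
    using h p by (intro nn_integral_eq_integral[OF int, symmetric]) (auto simp: eq[symmetric])
  finally show ?thesis unfolding eq z_def by simp
qed

section \<open>The queue fed at a constant rate\<close>

definition walk :: "real \<Rightarrow> 'w \<Rightarrow> nat \<Rightarrow> real" where
  "walk r w n = (\<Sum>i<n. r - D (Suc i) w)"

definition queue :: "real \<Rightarrow> 'w \<Rightarrow> nat \<Rightarrow> real" where
  "queue r w n = waiting (\<lambda>i. r - D (Suc i) w) n"

definition age :: "real \<Rightarrow> 'w \<Rightarrow> nat \<Rightarrow> real" where
  "age r w n = real (busy (\<lambda>i. r - D (Suc i) w) n)"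

text \<open>\<open>queue\<close> maximises over suffixes of the step sequence, not over prefixes as
  the maximum of \<open>walk\<close> does. The two differ pathwise, but reversing i.i.d. steps keeps
  their law, so this expectation is the G of the overview.\<close>

definition mean_queue :: "real \<Rightarrow> nat \<Rightarrow> real" where
  "mean_queue r n = expectation (\<lambda>w. queue r w n)"

definition mean_age :: "real \<Rightarrow> nat \<Rightarrow> real" where
  "mean_age r n = expectation (\<lambda>w. age r w n)"

lemma walk_measurable [measurable]: "(\<lambda>w. walk r w n) \<in> borel_measurable M"
  unfolding walk_def by measurable

lemma queue_measurable [measurable]: "(\<lambda>w. queue r w n) \<in> borel_measurable M"
  unfolding queue_def by (intro measurable_waiting) measurable

lemma age_measurable [measurable]: "(\<lambda>w. age r w n) \<in> borel_measurable M"
  unfolding age_def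
  by (intro measurable_compose[OF measurable_busy]) auto

lemma queue_nonneg [simp]: "0 \<le> queue r w n"
  by (simp add: queue_def)

lemma age_nonneg [simp]: "0 \<le> age r w n"
  by (simp add: age_def)

lemma queue_0 [simp]: "queue r w 0 = 0"
  by (simp add: queue_def)

lemma age_le: "age r w n \<le> n"
  by (simp add: age_def busy_le)

lemma AE_queue_le: "0 \<le> r \<Longrightarrow> AE w in M. queue r w n \<le> n * r"
  using D_nonneg by eventually_elim (auto simp: queue_def intro!: waiting_le)

lemma integrable_queue_power [simp, intro]: "0 \<le> r \<Longrightarrow> integrable M (\<lambda>w. queue r w n ^ k)"
  using AE_queue_le[of r n]
  by (intro integrable_const_bound[of _ "(n * r) ^ k"]) (auto elim!: eventually_mono intro!: power_mono)

lemma integrable_queue [simp, intro]: "0 \<le> r \<Longrightarrow> integrable M (\<lambda>w. queue r w n)"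
  using integrable_queue_power[of r n 1] by simp

lemma integrable_age [simp, intro]: "integrable M (\<lambda>w. age r w n)"
  using age_le[of r _ n] by (intro integrable_const_bound[of _ n]) auto

lemma integrable_D_Suc [simp, intro]: "integrable M (D (Suc i))"
  by (rule integrable_D) simp

lemma integrable_walk [simp, intro]: "integrable M (\<lambda>w. walk r w n)"
  unfolding walk_def by (intro Bochner_Integration.integrable_sum) auto

section \<open>Exchangeability of the steps and Spitzer's identity\<close>

lemma expectation_shift:
  fixes \<Psi> :: "(nat \<Rightarrow> real) \<Rightarrow> real"
  assumes meas: "(\<lambda>d. \<Psi> (\<lambda>i. r - d i)) \<in> borel_measurable (\<Pi>\<^sub>M i\<in>{..<n}. borel)"
    and cong: "\<And>z z'. (\<And>i. i < n \<Longrightarrow> z i = z' i) \<Longrightarrow> \<Psi> z = \<Psi> z'"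
    and s: "inj_on s {..<n}" "s ` {..<n} \<subseteq> {1..}"
  shows "expectation (\<lambda>w. \<Psi> (\<lambda>i. r - D (s i) w)) = expectation (\<lambda>w. \<Psi> (\<lambda>i. r - D (Suc i) w))"
  by (rule expectation_iid[where \<Phi>="\<lambda>d. \<Psi> (\<lambda>i. r - d i)" and t=Suc, OF s _ _ meas])
     (auto intro!: cong)

text \<open>A rotation of the n + 1 steps keeps their total, hence the indicator, but exchanges
  dropping the first step for dropping the last.\<close>

lemma expectation_cycle:
  fixes \<Psi> :: "(nat \<Rightarrow> real) \<Rightarrow> real"
  assumes meas: "\<And>z :: (nat \<Rightarrow> real) \<Rightarrow> nat \<Rightarrow> real.
      (\<And>i. i < n \<Longrightarrow> (\<lambda>d. z d i) \<in> borel_measurable (\<Pi>\<^sub>M i\<in>{..<Suc n}. borel)) \<Longrightarrow>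
      (\<lambda>d. \<Psi> (z d)) \<in> borel_measurable (\<Pi>\<^sub>M i\<in>{..<Suc n}. borel)"
    and cong: "\<And>z z'. (\<And>i. i < n \<Longrightarrow> z i = z' i) \<Longrightarrow> \<Psi> z = \<Psi> z'"
  shows "expectation (\<lambda>w. indicator {..0} (walk r w (Suc n)) * \<Psi> (\<lambda>i. r - D (Suc (Suc i)) w))
    = expectation (\<lambda>w. indicator {..0} (walk r w (Suc n)) * \<Psi> (\<lambda>i. r - D (Suc i) w))"
proof -
  let ?\<Psi> = "\<lambda>z. indicator {..0} (\<Sum>i<Suc n. z i) * \<Psi> (\<lambda>i. z (Suc i)) :: real"
  \<comment> \<open>The last demand moves to the front, so discarding index 0 afterwards leaves the
    first \<open>n\<close> demands in order.\<close>
  let ?s = "\<lambda>i. if i = 0 then Suc n else i"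
  have [measurable]: "(\<lambda>d. \<Psi> (\<lambda>i. r - d (Suc i))) \<in> borel_measurable (\<Pi>\<^sub>M i\<in>{..<Suc n}. borel)"
    by (intro meas borel_measurable_diff measurable_component_singleton) auto
  have "expectation (\<lambda>w. ?\<Psi> (\<lambda>i. r - D (?s i) w)) = expectation (\<lambda>w. ?\<Psi> (\<lambda>i. r - D (Suc i) w))"
  proof (rule expectation_shift[where n="Suc n"])
    show "(\<lambda>d. ?\<Psi> (\<lambda>i. r - d i)) \<in> borel_measurable (\<Pi>\<^sub>M i\<in>{..<Suc n}. borel)"
      by measurable
    fix z z' :: "nat \<Rightarrow> real" assume eq: "\<And>i. i < Suc n \<Longrightarrow> z i = z' i"
    then have "\<Psi> (\<lambda>i. z (Suc i)) = \<Psi> (\<lambda>i. z' (Suc i))" by (intro cong) auto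
    moreover have "(\<Sum>i<Suc n. z i) = (\<Sum>i<Suc n. z' i)" using eq by (intro sum.cong) auto
    ultimately show "?\<Psi> z = ?\<Psi> z'" by simp
  qed (auto simp: inj_on_def)
  moreover have "(\<Sum>i<Suc n. r - D (?s i) w) = walk r w (Suc n)" for w
    unfolding walk_def by (subst sum.lessThan_Suc_shift) simp
  ultimately show ?thesis by (simp add: walk_def del: sum.lessThan_Suc)
qed

text \<open>The positive part of the total is the sum of all steps on the event that the total is
  positive. By exchangeability each step contributes the same share.\<close>

lemma expectation_exchange_last:
  "expectation (\<lambda>w. indicator {0<..} (walk r w (Suc n)) * (r - D (Suc n) w))
    = expectation (\<lambda>w. max 0 (walk r w (Suc n))) / Suc n"
proof -
  let ?\<Psi> = "\<lambda>z. indicator {0<..} (\<Sum>i<Suc n. z i) * z n :: real"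
  let ?f = "\<lambda>j w. indicator {0<..} (walk r w (Suc n)) * (r - D (Suc j) w)"
  have eq: "expectation (?f j) = expectation (?f n)" if j: "j < Suc n" for j
  proof -
    let ?p = "Transposition.transpose j n"
    have p: "?p permutes {..<Suc n}" using j by (intro permutes_swap_id) auto
    have "expectation (\<lambda>w. ?\<Psi> (\<lambda>i. r - D (Suc (?p i)) w)) = expectation (\<lambda>w. ?\<Psi> (\<lambda>i. r - D (Suc i) w))"
    proof (rule expectation_shift[where n="Suc n"])
      fix z z' :: "nat \<Rightarrow> real" assume eq: "\<And>i. i < Suc n \<Longrightarrow> z i = z' i"
      then have "(\<Sum>i<Suc n. z i) = (\<Sum>i<Suc n. z' i)" by (intro sum.cong) auto
      then show "?\<Psi> z = ?\<Psi> z'" using eq by simp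
    next
      show "inj_on (\<lambda>i. Suc (?p i)) {..<Suc n}"
        by (rule inj_onI, drule Suc_inject, erule injD[OF permutes_inj[OF p]])
    qed auto
    moreover have "(\<Sum>i<Suc n. r - D (Suc (?p i)) w) = walk r w (Suc n)" for w
      unfolding walk_def using sum.permute[OF p, of "\<lambda>i. r - D (Suc i) w"] by (simp add: comp_def)
    ultimately show ?thesis by (simp add: walk_def del: sum.lessThan_Suc)
  qed
  have int: "integrable M (?f j)" for j
    by (rule Bochner_Integration.integrable_bound[of _ "\<lambda>w. r - D (Suc j) w"])
       (auto simp: indicator_def)
  have "expectation (\<lambda>w. max 0 (walk r w (Suc n))) = expectation (\<lambda>w. \<Sum>j<Suc n. ?f j w)"
    by (intro Bochner_Integration.integral_cong refl)
       (auto simp: walk_def sum_distrib_left[symmetric] indicator_def max_def simp del: sum.lessThan_Suc)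
  also have "\<dots> = (\<Sum>j<Suc n. expectation (?f j))"
    using int by (intro Bochner_Integration.integral_sum) auto
  also have "\<dots> = (\<Sum>j<Suc n. expectation (?f n))"
    by (rule sum.cong[OF refl], rule eq) simp
  finally show ?thesis by simp
qed

text \<open>
  Spitzer's identity. If the walk ends positive, the queue is the previous queue plus the last
  step; if not, the first step does not matter, and by exchangeability one may drop the last
  step instead.
\<close>

lemma mean_queue_Suc:
  assumes r: "0 \<le> r"
  shows "mean_queue r (Suc n) = mean_queue r n + expectation (\<lambda>w. max 0 (walk r w (Suc n))) / Suc n"
proof -
  let ?P = "\<lambda>w. indicator {0<..} (walk r w (Suc n)) :: real"
  let ?N = "\<lambda>w. indicator {..0} (walk r w (Suc n)) :: real"
  let ?q = "\<lambda>w. waiting (\<lambda>i. r - D (Suc (Suc i)) w) n"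
  have [measurable]: "?q \<in> borel_measurable M"
    by (intro measurable_waiting) measurable
  have AEq: "AE w in M. ?q w \<le> n * r"
    using D_nonneg by eventually_elim (auto simp: r intro!: waiting_le)
  have i1: "integrable M (\<lambda>w. ?P w * (r - D (Suc n) w))"
    by (rule Bochner_Integration.integrable_bound[of _ "\<lambda>w. r - D (Suc n) w"])
       (auto simp: indicator_def)
  have i2: "integrable M (\<lambda>w. ?P w * queue r w n)" "integrable M (\<lambda>w. ?N w * queue r w n)"
    by (rule Bochner_Integration.integrable_bound[of _ "\<lambda>w. queue r w n"]; auto simp: indicator_def r)+
  have i3: "integrable M (\<lambda>w. ?N w * ?q w)"
    using AEq by (intro integrable_const_bound[of _ "n * r"])
      (auto elim!: eventually_mono simp: indicator_def r)
  have "mean_queue r (Suc n) = expectation (\<lambda>w. ?P w * (r - D (Suc n) w) + (?P w * queue r w n + ?N w * ?q w))"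
    unfolding mean_queue_def queue_def walk_def waiting_Suc_cases ..
  also have "\<dots> = expectation (\<lambda>w. ?P w * (r - D (Suc n) w)) +
      (expectation (\<lambda>w. ?P w * queue r w n) + expectation (\<lambda>w. ?N w * ?q w))"
    using i1 i2 i3 by simp
  also have "expectation (\<lambda>w. ?N w * ?q w) = expectation (\<lambda>w. ?N w * queue r w n)"
    unfolding queue_def
    by (rule expectation_cycle) (auto intro!: measurable_waiting waiting_busy_cong[THEN conjunct1])
  also have "expectation (\<lambda>w. ?P w * queue r w n) + expectation (\<lambda>w. ?N w * queue r w n)
      = expectation (\<lambda>w. ?P w * queue r w n + ?N w * queue r w n)"
    using i2 by simp
  also have "\<dots> = mean_queue r n"
    unfolding mean_queue_def by (intro Bochner_Integration.integral_cong) (auto simp: indicator_def)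
  finally show ?thesis by (simp add: expectation_exchange_last)
qed

text \<open>The split used for the mean queue applies again, but a positive total now adds 1 instead
  of the last step, so no division by n + 1 appears. Formally this is the r-derivative of Spitzer's
  identity.\<close>

lemma mean_age_Suc:
  "mean_age r (Suc n) = mean_age r n + expectation (\<lambda>w. indicator {0<..} (walk r w (Suc n)))"
proof -
  let ?P = "\<lambda>w. indicator {0<..} (walk r w (Suc n)) :: real"
  let ?N = "\<lambda>w. indicator {..0} (walk r w (Suc n)) :: real"
  let ?q = "\<lambda>w. real (busy (\<lambda>i. r - D (Suc (Suc i)) w) n)"
  have [measurable]: "?q \<in> borel_measurable M"
    by (intro measurable_compose[OF measurable_busy]) auto
  have i1: "integrable M ?P"
    by (intro integrable_const_bound[of _ 1]) (auto simp: indicator_def)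
  have i2: "integrable M (\<lambda>w. ?P w * age r w n)" "integrable M (\<lambda>w. ?N w * age r w n)"
    by (rule Bochner_Integration.integrable_bound[of _ "\<lambda>w. age r w n"]; auto simp: indicator_def)+
  have i3: "integrable M (\<lambda>w. ?N w * ?q w)"
    by (intro integrable_const_bound[of _ n]) (auto simp: indicator_def busy_le)
  have "mean_age r (Suc n) = expectation (\<lambda>w. ?P w + (?P w * age r w n + ?N w * ?q w))"
    unfolding mean_age_def age_def walk_def busy_Suc_cases ..
  also have "\<dots> = expectation ?P +
      (expectation (\<lambda>w. ?P w * age r w n) + expectation (\<lambda>w. ?N w * ?q w))"
    using i1 i2 i3 by simp
  also have "expectation (\<lambda>w. ?N w * ?q w) = expectation (\<lambda>w. ?N w * age r w n)"
    unfolding age_def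
  proof (rule expectation_cycle)
    fix z z' :: "nat \<Rightarrow> real" assume "\<And>i. i < n \<Longrightarrow> z i = z' i"
    then show "real (busy z n) = real (busy z' n)" using waiting_busy_cong by metis
  qed (auto intro!: measurable_compose[OF measurable_busy])
  also have "expectation (\<lambda>w. ?P w * age r w n) + expectation (\<lambda>w. ?N w * age r w n)
      = expectation (\<lambda>w. ?P w * age r w n + ?N w * age r w n)"
    using i2 by simp
  also have "\<dots> = mean_age r n"
    unfolding mean_age_def by (intro Bochner_Integration.integral_cong) (auto simp: indicator_def)
  finally show ?thesis by simp
qed

lemma mean_queue_mono: "0 \<le> r \<Longrightarrow> incseq (mean_queue r)"
  by (rule incseq_SucI) (auto simp: mean_queue_Suc)

lemma mean_age_mono: "incseq (mean_age r)"
  by (rule incseq_SucI) (auto simp: mean_age_Suc)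

lemma mean_queue_subgradient:
  assumes "0 \<le> r" "0 \<le> r'"
  shows "mean_queue r n + mean_age r n * (r' - r) \<le> mean_queue r' n"
proof -
  have "mean_queue r n + mean_age r n * (r' - r) = expectation (\<lambda>w. queue r w n + age r w n * (r' - r))"
    unfolding mean_queue_def mean_age_def using assms by simp
  also have "\<dots> \<le> mean_queue r' n"
    unfolding mean_queue_def using assms waiting_subgradient_const[of r "\<lambda>i. D (Suc i) _" n r']
    by (intro integral_mono) (auto simp flip: queue_def age_def)
  finally show ?thesis .
qed

subsection \<open>Exponential moments\<close>

definition mgf :: "real \<Rightarrow> real \<Rightarrow> real" where
  "mgf r \<theta> = exp (\<theta> * r) * (lam / (lam + \<theta>))"

lemma mgf_pos: "0 \<le> \<theta> \<Longrightarrow> 0 < mgf r \<theta>"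
  using lam_pos by (simp add: mgf_def)

lemma expectation_exp_walk:
  assumes \<theta>: "0 \<le> \<theta>"
  shows "integrable M (\<lambda>w. exp (\<theta> * walk r w n))" "expectation (\<lambda>w. exp (\<theta> * walk r w n)) = mgf r \<theta> ^ n"
proof -
  let ?X = "\<lambda>i w. exp (\<theta> * (r - D i w))"
  have eq: "exp (\<theta> * walk r w n) = (\<Prod>i\<in>{1..n}. ?X i w)" for w
    unfolding walk_def sum_distrib_left by (subst exp_sum) (auto simp: prod.atLeast1_atMost_eq)
  have ind: "indep_vars (\<lambda>_. borel) ?X {1..n}"
    by (rule indep_vars_compose2[where Y="\<lambda>i x. exp (\<theta> * (r - x))", OF indep_vars_subset[OF indep]]) auto
  have X: "integrable M (?X i)" "expectation (?X i) = mgf r \<theta>" if "i \<in> {1..n}" for i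
  proof -
    have "?X i w = exp (\<theta> * r) * exp (- \<theta> * D i w)" for w
      by (simp add: exp_add[symmetric] algebra_simps)
    then show "integrable M (?X i)" "expectation (?X i) = mgf r \<theta>"
      using expectation_exp_D[of i \<theta>] that \<theta> by (auto simp: mgf_def)
  qed
  show "integrable M (\<lambda>w. exp (\<theta> * walk r w n))"
    unfolding eq using indep_vars_integrable[OF _ ind X(1)] by simp
  show "expectation (\<lambda>w. exp (\<theta> * walk r w n)) = mgf r \<theta> ^ n"
    unfolding eq using indep_vars_lebesgue_integral[OF _ ind X(1)] X(2) by simp
qed

text \<open>Chernoff's method: x / (positive part) and the indicator of x > 0 are dominated by
  multiples of exp (\<theta> x). For the positive part, e x <= exp x gives the best multiple, 1 / (e
  \<theta>), and this is the e of the final bound.\<close>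

lemma expectation_walk_pos_le:
  assumes \<theta>: "0 < \<theta>"
  shows "expectation (\<lambda>w. max 0 (walk r w n)) \<le> mgf r \<theta> ^ n / (exp 1 * \<theta>)"
    and "expectation (\<lambda>w. indicator {0<..} (walk r w n)) \<le> mgf r \<theta> ^ n"
proof -
  note E = expectation_exp_walk[OF less_imp_le[OF \<theta>]]
  have "max 0 (walk r w n) \<le> exp (\<theta> * walk r w n) / (exp 1 * \<theta>)" for w
    using \<theta> exp_ge_linear[of "\<theta> * walk r w n"] by (auto simp: field_simps)
  then have "expectation (\<lambda>w. max 0 (walk r w n)) \<le> expectation (\<lambda>w. exp (\<theta> * walk r w n) / (exp 1 * \<theta>))"
    using E(1) by (intro integral_mono) auto
  then show "expectation (\<lambda>w. max 0 (walk r w n)) \<le> mgf r \<theta> ^ n / (exp 1 * \<theta>)"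
    using E(2) by simp
  have "expectation (\<lambda>w. indicator {0<..} (walk r w n)) \<le> expectation (\<lambda>w. exp (\<theta> * walk r w n))"
    using E(1) \<theta> by (intro integral_mono)
      (auto simp: indicator_def intro!: integrable_const_bound[of _ 1] one_le_exp_iff[THEN iffD2])
  then show "expectation (\<lambda>w. indicator {0<..} (walk r w n)) \<le> mgf r \<theta> ^ n"
    using E(2) by simp
qed

lemma indep_queue_D: "indep_var borel (\<lambda>w. queue r w n) borel (D (Suc n))"
proof -
  have "indep_var borel (\<lambda>w. waiting (\<lambda>i. r - D (Suc i) w) n) borel (D (Suc n))"
  proof (rule indep_from_past[where A="{1..n}" and F="\<lambda>d. waiting (\<lambda>i. r - d (Suc i)) n"])
    show "(\<lambda>d. waiting (\<lambda>i. r - d (Suc i)) n) \<in> borel_measurable (\<Pi>\<^sub>M i\<in>{1..n}. borel)"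
      by (intro measurable_waiting borel_measurable_diff measurable_component_singleton) auto
    show "waiting (\<lambda>i. r - restrict d {1..n} (Suc i)) n = waiting (\<lambda>i. r - d (Suc i)) n" for d
      using waiting_busy_cong[of n "\<lambda>i. r - restrict d {1..n} (Suc i)" "\<lambda>i. r - d (Suc i)"] by simp
  qed auto
  then show ?thesis unfolding queue_def .
qed

lemma queue_Suc: "queue r w (Suc n) = max 0 (queue r w n + r - D (Suc n) w)"
  by (simp add: queue_def algebra_simps)

text \<open>Since exp (max 0 x) <= 1 + exp x, one step of the queue takes the exponential moment m
  to at most 1 + \<open>mgf r \<theta>\<close> m. The bound is the fixed point of this map, and it
  is uniform in \<open>n\<close>.\<close>

lemma expectation_exp_queue_le:
  assumes \<theta>: "0 < \<theta>" and r: "0 \<le> r" and g: "mgf r \<theta> < 1"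
  shows "integrable M (\<lambda>w. exp (\<theta> * queue r w n))"
    and "expectation (\<lambda>w. exp (\<theta> * queue r w n)) \<le> 1 / (1 - mgf r \<theta>)"
proof -
  show int: "integrable M (\<lambda>w. exp (\<theta> * queue r w n))" for n
    using AE_queue_le[OF r, of n] \<theta>
    by (intro integrable_const_bound[of _ "exp (\<theta> * (n * r))"]) (auto elim!: eventually_mono)
  show "expectation (\<lambda>w. exp (\<theta> * queue r w n)) \<le> 1 / (1 - mgf r \<theta>)"
  proof (induction n)
    case 0
    then show ?case using g mgf_pos[of \<theta> r] \<theta> by (simp add: prob_space field_simps)
  next
    case (Suc n)
    let ?f = "\<lambda>w. exp (\<theta> * queue r w n)" and ?g = "\<lambda>w. exp (- \<theta> * D (Suc n) w)"
    have ind: "indep_var borel ?f borel ?g"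
      using indep_var_compose[OF indep_queue_D[of r n], of "\<lambda>x. exp (\<theta> * x)" borel "\<lambda>x. exp (- \<theta> * x)" borel]
      by (simp add: comp_def)
    have g': "integrable M ?g" "expectation ?g = lam / (lam + \<theta>)"
      using expectation_exp_D[of "Suc n" \<theta>] \<theta> by auto
    note fg = indep_var_integrable[OF ind int g'(1)] indep_var_lebesgue_integral[OF ind int g'(1)]
    have "exp (\<theta> * queue r w (Suc n)) \<le> 1 + exp (\<theta> * r) * (?f w * ?g w)" for w
      by (auto simp: queue_Suc max_def exp_add[symmetric] algebra_simps)
    then have "expectation (\<lambda>w. exp (\<theta> * queue r w (Suc n))) \<le> expectation (\<lambda>w. 1 + exp (\<theta> * r) * (?f w * ?g w))"
      using int fg(1) by (intro integral_mono) auto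
    also have "\<dots> = 1 + mgf r \<theta> * expectation ?f"
      using fg g'(2) by (simp add: prob_space mgf_def)
    also have "\<dots> \<le> 1 + mgf r \<theta> * (1 / (1 - mgf r \<theta>))"
      using Suc mgf_pos[of \<theta> r] \<theta> by (intro add_left_mono mult_left_mono) auto
    also have "\<dots> = 1 / (1 - mgf r \<theta>)" using g by (simp add: field_simps)
    finally show ?case .
  qed
qed

subsection \<open>The stationary mean\<close>

definition mean_square :: "real \<Rightarrow> nat \<Rightarrow> real" where
  "mean_square r n = expectation (\<lambda>w. (queue r w n)\<^sup>2)"

lemma mean_square_le:
  assumes \<theta>: "0 < \<theta>" and r: "0 \<le> r" and g: "mgf r \<theta> < 1"
  shows "mean_square r n \<le> 2 / \<theta>\<^sup>2 * (1 / (1 - mgf r \<theta>))"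
proof -
  have "(queue r w n)\<^sup>2 \<le> 2 / \<theta>\<^sup>2 * exp (\<theta> * queue r w n)" for w
    using exp_ge_square[of "\<theta> * queue r w n"] \<theta> by (simp add: field_simps)
  then have "mean_square r n \<le> expectation (\<lambda>w. 2 / \<theta>\<^sup>2 * exp (\<theta> * queue r w n))"
    unfolding mean_square_def using expectation_exp_queue_le(1)[OF assms] r
    by (intro integral_mono) auto
  also have "\<dots> \<le> 2 / \<theta>\<^sup>2 * (1 / (1 - mgf r \<theta>))"
    using mult_left_mono[OF expectation_exp_queue_le(2)[OF assms, of n], of "2 / \<theta>\<^sup>2"] by simp
  finally show ?thesis .
qed

text \<open>Adding an older step can only enlarge the largest suffix sum, and the queue without that
  step has the law of the shorter one.\<close>

lemma mean_square_mono:
  assumes r: "0 \<le> r"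
  shows "incseq (mean_square r)"
proof (rule incseq_SucI)
  fix n
  let ?q = "\<lambda>w. waiting (\<lambda>i. r - D (Suc (Suc i)) w) n"
  have [measurable]: "?q \<in> borel_measurable M"
    by (intro measurable_waiting) measurable
  have AEq: "AE w in M. ?q w \<le> n * r"
    using D_nonneg by eventually_elim (auto simp: r intro!: waiting_le)
  have int: "integrable M (\<lambda>w. (?q w)\<^sup>2)"
    using AEq by (intro integrable_const_bound[of _ "(n * r)\<^sup>2"])
      (auto elim!: eventually_mono intro!: power_mono)
  have "mean_square r n = expectation (\<lambda>w. (?q w)\<^sup>2)"
    unfolding mean_square_def queue_def
  proof (rule expectation_shift[symmetric])
    show "(\<lambda>d. (waiting (\<lambda>i. r - d i) n)\<^sup>2) \<in> borel_measurable (\<Pi>\<^sub>M i\<in>{..<n}. borel)"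
      by (intro borel_measurable_power measurable_waiting borel_measurable_diff measurable_component_singleton) auto
  qed (auto simp: inj_on_def intro!: arg_cong[where f="\<lambda>x. x\<^sup>2"] waiting_busy_cong[THEN conjunct1])
  also have "\<dots> \<le> mean_square r (Suc n)"
    unfolding mean_square_def
    using int integrable_queue_power[OF r, of "Suc n" 2]
    by (intro integral_mono)
       (auto simp: queue_def waiting_Suc_shift simp del: waiting.simps intro!: power_mono)
  finally show "mean_square r n \<le> mean_square r (Suc n)" .
qed

section \<open>Lost demand and the second-moment recursion\<close>

definition lost :: "real \<Rightarrow> 'w \<Rightarrow> nat \<Rightarrow> real" where
  "lost r w n = max 0 (D (Suc n) w - (queue r w n + r))"

lemma lost_measurable [measurable]: "(\<lambda>w. lost r w n) \<in> borel_measurable M"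
  unfolding lost_def by measurable

lemma lost_eq: "lost r w n = queue r w (Suc n) - queue r w n - r + D (Suc n) w"
  by (simp add: lost_def queue_Suc)

lemma integrable_lost: "0 \<le> r \<Longrightarrow> integrable M (\<lambda>w. lost r w n)"
  unfolding lost_eq by simp

lemma expectation_lost:
  assumes "0 \<le> r"
  shows "expectation (\<lambda>w. lost r w n) = 1 / lam - r + (mean_queue r (Suc n) - mean_queue r n)"
  unfolding lost_eq mean_queue_def using assms expectation_D[of "Suc n"] by (simp add: prob_space)

lemma nn_integral_lost:
  assumes r: "0 \<le> r" and k: "k \<noteq> 0"
  shows "(\<integral>\<^sup>+w. ennreal (lost r w n ^ k) \<partial>M)
      = ennreal (fact k / lam ^ k) * (\<integral>\<^sup>+w. ennreal (exp (- lam * (queue r w n + r))) \<partial>M)"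
proof -
  have "(\<integral>\<^sup>+w. ennreal (lost r w n ^ k) \<partial>M)
      = (\<integral>\<^sup>+w. \<integral>\<^sup>+w'. ennreal (max 0 (D (Suc n) w' - (queue r w n + r)) ^ k) \<partial>M \<partial>M)"
    unfolding lost_def
    using nn_integral_indep_var[OF indep_queue_D, where f="\<lambda>(x, y). ennreal (max 0 (y - (x + r)) ^ k)"]
    by simp
  also have "\<dots> = (\<integral>\<^sup>+w. ennreal (fact k / lam ^ k) * ennreal (exp (- lam * (queue r w n + r))) \<partial>M)"
    using r lam_pos k
    by (intro nn_integral_cong, subst nn_integral_excess)
       (auto simp: ennreal_mult'[symmetric] mult.commute)
  finally show ?thesis by (simp add: nn_integral_cmult)
qed

text \<open>Given that demand exceeds what is available, the excess is exponential again by
  memorylessness, and its second moment is 2 / lam times its mean. This lets the recursion for the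
  mean square be written in terms of \<open>mean_queue\<close> alone.\<close>

lemma expectation_lost_square:
  assumes r: "0 \<le> r"
  shows "integrable M (\<lambda>w. (lost r w n)\<^sup>2)"
    and "expectation (\<lambda>w. (lost r w n)\<^sup>2) = 2 / lam * expectation (\<lambda>w. lost r w n)"
proof -
  have l0: "0 \<le> lost r w n" for w by (simp add: lost_def)
  have "(\<integral>\<^sup>+w. ennreal ((lost r w n)\<^sup>2) \<partial>M)
      = ennreal (2 / lam) * (ennreal (1 / lam) * (\<integral>\<^sup>+w. ennreal (exp (- lam * (queue r w n + r))) \<partial>M))"
    using nn_integral_lost[OF r, of 2 n] lam_pos
    by (simp add: mult.assoc[symmetric] ennreal_mult'[symmetric] power2_eq_square)
  also have "\<dots> = ennreal (2 / lam) * (\<integral>\<^sup>+w. ennreal (lost r w n) \<partial>M)"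
    using nn_integral_lost[OF r, of 1 n] by simp
  also have "\<dots> = ennreal (2 / lam * expectation (\<lambda>w. lost r w n))"
    using lam_pos l0 by (subst nn_integral_eq_integral[OF integrable_lost[OF r]])
      (auto simp: ennreal_mult'[symmetric])
  finally have eq: "(\<integral>\<^sup>+w. ennreal ((lost r w n)\<^sup>2) \<partial>M) = ennreal (2 / lam * expectation (\<lambda>w. lost r w n))" .
  show "integrable M (\<lambda>w. (lost r w n)\<^sup>2)"
    using eq by (intro integrableI_nn_integral_finite[OF _ _ eq]) auto
  show "expectation (\<lambda>w. (lost r w n)\<^sup>2) = 2 / lam * expectation (\<lambda>w. lost r w n)"
    using eq lam_pos l0 by (subst integral_eq_nn_integral) auto
qed

text \<open>With x = queue + r - D, the square of the new queue is x squared minus the square of the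
  lost demand. The first has known moments because the queue is independent of the next demand; the
  second is reduced to a mean.\<close>

lemma mean_square_Suc:
  assumes r: "0 \<le> r"
  shows "mean_square r (Suc n) = mean_square r n + r\<^sup>2 - 2 * (1 / lam - r) * mean_queue r n
    - 2 / lam * (mean_queue r (Suc n) - mean_queue r n)"
proof -
  let ?q = "\<lambda>w. queue r w n" and ?D = "D (Suc n)"
  have i: "integrable M (\<lambda>w. ?q w * ?D w)" "expectation (\<lambda>w. ?q w * ?D w) = mean_queue r n * (1 / lam)"
    using indep_var_integrable[OF indep_queue_D[of r n]] indep_var_lebesgue_integral[OF indep_queue_D[of r n]]
      r expectation_D[of "Suc n"] by (auto simp: mean_queue_def)
  have iD: "integrable M (\<lambda>w. (?D w)\<^sup>2)" by (rule integrable_D_power) simp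
  have "(queue r w (Suc n))\<^sup>2 = (?q w)\<^sup>2 + r\<^sup>2 + 2 * r * ?q w - 2 * (?q w * ?D w) - 2 * r * ?D w + (?D w)\<^sup>2 - (lost r w n)\<^sup>2" for w
    unfolding queue_Suc lost_def by (simp add: max_def power2_eq_square algebra_simps)
  then have "mean_square r (Suc n) = expectation (\<lambda>w.
      (?q w)\<^sup>2 + r\<^sup>2 + 2 * r * ?q w - 2 * (?q w * ?D w) - 2 * r * ?D w + (?D w)\<^sup>2 - (lost r w n)\<^sup>2)"
    unfolding mean_square_def by simp
  also have "\<dots> = mean_square r n + r\<^sup>2 + 2 * r * mean_queue r n - 2 * (mean_queue r n * (1 / lam))
      - 2 * r * (1 / lam) + 2 / lam\<^sup>2 - 2 / lam * (1 / lam - r + (mean_queue r (Suc n) - mean_queue r n))"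
    using r i iD expectation_lost_square[OF r, of n] expectation_lost[OF r, of n] expectation_D[of "Suc n"]
      expectation_D_square[of "Suc n"]
    by (simp add: prob_space mean_square_def mean_queue_def)
  also have "\<dots> = mean_square r n + r\<^sup>2 - 2 * (1 / lam - r) * mean_queue r n
    - 2 / lam * (mean_queue r (Suc n) - mean_queue r n)"
    using lam_pos by (simp add: field_simps power2_eq_square)
  finally show ?thesis .
qed

lemma mgf_less_1:
  assumes "0 \<le> r" "r < 1 / lam"
  obtains \<theta> where "0 < \<theta>" "mgf r \<theta> < 1"
proof (cases "r = 0")
  case True
  then show ?thesis using that[of lam] lam_pos by (simp add: mgf_def)
next
  case False
  have *: "lam * r < 1" "0 < lam * r" using assms False lam_pos by (auto simp: field_simps)
  have "exp (- (1 - lam * r)) > 1 + - (1 - lam * r)"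
    using exp_minus_greater[of "1 - lam * r"] * by simp
  then have "lam * r * exp (1 - lam * r) < 1"
    using exp_minus_inverse[of "1 - lam * r"] mult_strict_right_mono[of "lam * r" "exp (- (1 - lam * r))" "exp (1 - lam * r)"]
    by (simp add: mult.commute)
  \<comment> \<open>The exponent 1 / r - lam is where \<open>mgf r\<close> attains its
    minimum.\<close>
  moreover have "mgf r (1 / r - lam) = lam * r * exp (1 - lam * r)"
    using False by (simp add: mgf_def algebra_simps)
  ultimately show ?thesis using that[of "1 / r - lam"] assms False lam_pos
    by (simp add: field_simps)
qed

text \<open>
  The Pollaczek--Khinchine formula for service times \<open>r\<close>: the mean square of the queue converges,
  so its drift vanishes in the limit.
\<close>

definition stat_mean :: "real \<Rightarrow> real" where
  "stat_mean r = r\<^sup>2 / (2 * (1 / lam - r))"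

lemma mean_queue_tendsto:
  assumes r: "0 \<le> r" "r < 1 / lam"
  shows "mean_queue r \<longlonglongrightarrow> stat_mean r"
proof -
  obtain \<theta> where \<theta>: "0 < \<theta>" "mgf r \<theta> < 1" using mgf_less_1[OF r] .
  \<comment> \<open>Both the mean and the mean square increase in \<open>n\<close>. Substituting
    these signs into the recursion for the mean square already bounds the mean by its eventual
    limit.\<close>
  have "mean_queue r n \<le> stat_mean r" for n
  proof -
    have "2 / lam * (mean_queue r (Suc n) - mean_queue r n) \<ge> 0"
      using mean_queue_mono[OF r(1)] lam_pos by (simp add: incseq_SucD)
    moreover have "mean_square r n \<le> mean_square r (Suc n)"
      using mean_square_mono[OF r(1)] by (simp add: incseq_SucD)
    ultimately have "2 * (1 / lam - r) * mean_queue r n \<le> r\<^sup>2"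
      using mean_square_Suc[OF r(1), of n] by linarith
    then show ?thesis using r by (simp add: stat_mean_def field_simps)
  qed
  then obtain l where l: "mean_queue r \<longlonglongrightarrow> l"
    using incseq_convergent[OF mean_queue_mono[OF r(1)]] by blast
  obtain v where v: "mean_square r \<longlonglongrightarrow> v"
    using incseq_convergent[OF mean_square_mono[OF r(1)]] mean_square_le[OF \<theta>(1) r(1) \<theta>(2)] by blast
  have "(\<lambda>n. mean_square r (Suc n) - mean_square r n) \<longlonglongrightarrow> v - v"
    using v LIMSEQ_Suc[OF v] by (intro tendsto_diff)
  moreover have "mean_square r (Suc n) - mean_square r n = r\<^sup>2 - 2 * (1 / lam - r) * mean_queue r n
    - 2 / lam * (mean_queue r (Suc n) - mean_queue r n)" for n
    using mean_square_Suc[OF r(1), of n] by simp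
  moreover have "(\<lambda>n. r\<^sup>2 - 2 * (1 / lam - r) * mean_queue r n
    - 2 / lam * (mean_queue r (Suc n) - mean_queue r n)) \<longlonglongrightarrow> r\<^sup>2 - 2 * (1 / lam - r) * l - 2 / lam * (l - l)"
    using l LIMSEQ_Suc[OF l] by (intro tendsto_intros)
  ultimately have "r\<^sup>2 - 2 * (1 / lam - r) * l = 0"
    using LIMSEQ_unique by fastforce
  then have "l = stat_mean r" using r by (simp add: stat_mean_def field_simps)
  then show ?thesis using l by simp
qed

section \<open>Geometric convergence of the mean queue and the mean age\<close>

lemma stat_mean_deriv:
  assumes "r < 1 / lam"
  shows "(stat_mean has_field_derivative (r * (2 / lam - r) / (2 * (1 / lam - r)\<^sup>2))) (at r)"
proof -
  define c where "c = 1 / lam"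
  have c: "c - r \<noteq> 0" "2 / lam = 2 * c" using assms by (auto simp: c_def)
  have "((\<lambda>x. x\<^sup>2 / (2 * (c - x))) has_field_derivative
      (2 * r * (2 * (c - r)) - r\<^sup>2 * (- 2)) / (2 * (c - r) * (2 * (c - r)))) (at r)"
    using c by (auto intro!: derivative_eq_intros)
  moreover have "(2 * r * (2 * (c - r)) - r\<^sup>2 * (- 2)) / (2 * (c - r) * (2 * (c - r)))
      = r * (2 * c - r) / (2 * (c - r)\<^sup>2)"
    using c by (simp add: divide_simps power2_eq_square) (simp add: algebra_simps)
  ultimately show ?thesis
    unfolding stat_mean_def c_def[symmetric] c(2) by simp
qed

text \<open>Each \<open>mean_age r n\<close> is a subgradient at \<open>r\<close> of the mean queue
  as a function of the rate. In the limit it becomes a subgradient of \<open>stat_mean\<close> at an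
  interior point where \<open>stat_mean\<close> is differentiable, so the limit is the derivative
  \<open>s\<close>. Monotonicity and the Chernoff tail then give the two bounds.\<close>

lemma mean_age_bounds:
  assumes r: "0 < r" "r < 1 / lam" and \<theta>: "0 < \<theta>" "mgf r \<theta> < 1"
  defines "s \<equiv> r * (2 / lam - r) / (2 * (1 / lam - r)\<^sup>2)"
  shows "mean_age r n \<le> s" "s \<le> mean_age r n + mgf r \<theta> ^ Suc n / (1 - mgf r \<theta>)"
proof -
  \<comment> \<open>Any rate strictly between \<open>r\<close> and 1 / lam would serve: the increase
    of the mean queue up to it bounds the subgradients uniformly in \<open>n\<close>.\<close>
  define r' where "r' = (r + 1 / lam) / 2"
  have r': "r < r'" "r' < 1 / lam" using r by (auto simp: r'_def)
  have "mean_age r n \<le> stat_mean r' / (r' - r)" for n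
  proof -
    have "0 \<le> mean_queue r n" unfolding mean_queue_def by simp
    moreover have "mean_queue r' n \<le> stat_mean r'"
      using r r' by (intro incseq_le[OF mean_queue_mono mean_queue_tendsto]) auto
    ultimately have "mean_age r n * (r' - r) \<le> stat_mean r'"
      using mean_queue_subgradient[of r r' n] r r' by linarith
    then show ?thesis using r' by (simp add: field_simps)
  qed
  then obtain q where q: "mean_age r \<longlonglongrightarrow> q"
    using incseq_convergent[OF mean_age_mono[of r]] by blast
  have sub: "stat_mean r + q * (x - r) \<le> stat_mean x" if "0 \<le> x" "x < 1 / lam" for x
  proof (rule LIMSEQ_le)
    show "(\<lambda>n. mean_queue r n + mean_age r n * (x - r)) \<longlonglongrightarrow> stat_mean r + q * (x - r)"
      using q mean_queue_tendsto[of r] r by (intro tendsto_intros) auto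
    show "mean_queue x \<longlonglongrightarrow> stat_mean x" using that by (rule mean_queue_tendsto)
  qed (use mean_queue_subgradient[of r x] r that in auto)
  have "s - q = 0"
  proof (rule DERIV_local_min[where d="min r (1 / lam - r)"])
    show "((\<lambda>x. stat_mean x - q * x) has_field_derivative s - q) (at r)"
      unfolding s_def using r by (auto intro!: derivative_eq_intros stat_mean_deriv)
    show "\<forall>x. \<bar>r - x\<bar> < min r (1 / lam - r) \<longrightarrow> stat_mean r - q * r \<le> stat_mean x - q * x"
      using sub by (auto simp: algebra_simps abs_if split: if_splits)
  qed (use r in auto)
  then have qs: "q = s" by simp
  show "mean_age r n \<le> s"
    using incseq_le[OF mean_age_mono q] qs by simp
  show "s \<le> mean_age r n + mgf r \<theta> ^ Suc n / (1 - mgf r \<theta>)"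
  proof -
    have "q \<le> mean_age r n + 1 * (mgf r \<theta> ^ Suc n / (1 - mgf r \<theta>))"
    proof (rule geometric_tail_bound[OF q])
      fix k show "mean_age r (Suc k) \<le> mean_age r k + 1 * mgf r \<theta> ^ Suc k"
        using expectation_walk_pos_le(2)[OF \<theta>(1), of r "Suc k"] by (simp add: mean_age_Suc)
    qed (use \<theta> mgf_pos[of \<theta> r] in auto)
    then show ?thesis using qs by simp
  qed
qed

text \<open>In the tail of Spitzer's series the weight 1 / k is replaced by its largest value 1 / (n
  + 1), which leaves a geometric series.\<close>

lemma stat_mean_le:
  assumes r: "0 \<le> r" "r < 1 / lam" and \<theta>: "0 < \<theta>" "mgf r \<theta> < 1"
  shows "stat_mean r \<le> mean_queue r n
    + 1 / (exp 1 * \<theta> * real (Suc n)) * (mgf r \<theta> ^ Suc n / (1 - mgf r \<theta>))"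
proof (rule geometric_tail_bound[OF mean_queue_tendsto[OF r]])
  fix k assume k: "n \<le> k"
  have "expectation (\<lambda>w. max 0 (walk r w (Suc k))) / Suc k
      \<le> (mgf r \<theta> ^ Suc k / (exp 1 * \<theta>)) / Suc k"
    by (intro divide_right_mono expectation_walk_pos_le \<theta>) auto
  also have "\<dots> \<le> (mgf r \<theta> ^ Suc k / (exp 1 * \<theta>)) / Suc n"
    using k \<theta> mgf_pos[of \<theta> r] by (intro divide_left_mono) auto
  finally show "mean_queue r (Suc k) \<le> mean_queue r k + 1 / (exp 1 * \<theta> * real (Suc n)) * mgf r \<theta> ^ Suc k"
    using mean_queue_Suc[OF r(1), of k] by (simp add: mult_ac)
qed (use \<theta> mgf_pos[of \<theta> r] in auto)

end

section \<open>Sample paths of a policy\<close>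

definition arrival :: "nat \<Rightarrow> policy \<Rightarrow> (nat \<Rightarrow> real) \<Rightarrow> nat \<Rightarrow> real" where
  "arrival L f d t = fst (state_at L f d t) 1"

definition stock :: "nat \<Rightarrow> policy \<Rightarrow> (nat \<Rightarrow> real) \<Rightarrow> nat \<Rightarrow> real" where
  "stock L f d t = snd (state_at L f d t)"

definition unmet :: "nat \<Rightarrow> policy \<Rightarrow> (nat \<Rightarrow> real) \<Rightarrow> nat \<Rightarrow> real" where
  "unmet L f d t = max 0 (d t - stock L f d t - arrival L f d t)"

lemma stock_nonneg: "0 \<le> stock L f d t"
  by (cases t) (auto simp: stock_def init_state_def next_state_def)

lemma stock_1: "stock L f d (Suc 0) = 0"
  by (simp add: stock_def init_state_def)

lemma stock_Suc: "1 \<le> t \<Longrightarrow> stock L f d (Suc t) = max 0 (stock L f d t + arrival L f d t - d t)"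
  by (simp add: stock_def arrival_def next_state_def)

lemma unmet_eq: "1 \<le> t \<Longrightarrow> unmet L f d t = stock L f d (Suc t) - stock L f d t - arrival L f d t + d t"
  by (simp add: stock_Suc unmet_def)

lemma period_cost_eq:
  "1 \<le> t \<Longrightarrow> period_cost h p L f d t = h * stock L f d (Suc t) + p * unmet L f d t"
  unfolding stock_Suc unmet_def
  by (simp add: period_cost_def stock_def arrival_def Let_def split_beta max.commute algebra_simps)

lemma state_at_cong:
  "(\<And>s. 1 \<le> s \<Longrightarrow> s < t \<Longrightarrow> d s = d' s) \<Longrightarrow> state_at L f d t = state_at L f d' t"
  by (induction t) auto

lemma waiting_le_stock:
  assumes s: "1 \<le> s"
  shows "waiting (\<lambda>i. arrival L f d (s + i) - d (s + i)) n \<le> stock L f d (s + n)"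
proof (induction n)
  case 0
  then show ?case by (simp add: stock_nonneg)
next
  case (Suc n)
  then show ?case using stock_Suc[of "s + n" L f d] s by simp
qed

lemma stock_eq_waiting:
  assumes s: "1 \<le> s" and 0: "stock L f d s = 0"
  shows "stock L f d (s + n) = waiting (\<lambda>i. arrival L f d (s + i) - d (s + i)) n"
proof (induction n)
  case (Suc n)
  then show ?case using stock_Suc[of "s + n" L f d] s by (simp add: add_diff_eq)
qed (simp add: 0)

text \<open>The first order sits at position L in period 2 and moves down one place per period, so
  it stays on the diagonal i + t = L + 2. Below that diagonal the pipeline still holds the initial
  zeros.\<close>

lemma pipeline_0: "1 \<le> i \<Longrightarrow> i \<le> L \<Longrightarrow> i + t \<le> Suc L \<Longrightarrow> fst (state_at L f d t) i = 0"
proof (induction t arbitrary: i)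
  case (Suc t)
  then show ?case by (auto simp: init_state_def next_state_def)
qed (auto simp: init_state_def)

lemma arrival_early: "1 \<le> L \<Longrightarrow> t \<le> L \<Longrightarrow> arrival L f d t = 0"
  unfolding arrival_def by (rule pipeline_0) auto

lemma pipeline_order:
  "1 \<le> t \<Longrightarrow> j < L \<Longrightarrow> fst (state_at L f d (Suc t + j)) (L - j) = f t (state_at L f d t)"
proof (induction j)
  case (Suc j)
  have "fst (state_at L f d (Suc t + Suc j)) (L - Suc j) = fst (state_at L f d (Suc t + j)) (L - j)"
    using Suc.prems by (simp add: next_state_def Suc_diff_Suc)
  then show ?case using Suc by simp
qed (simp add: next_state_def)

lemma arrival_order:
  assumes "1 \<le> t" "1 \<le> L"
  shows "arrival L f d (t + L) = f t (state_at L f d t)"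
  using pipeline_order[of t "L - 1" L f d] assms by (simp add: arrival_def)

lemma borel_measurable_borel_nonneg: "g \<in> measurable M borel_nonneg \<Longrightarrow> g \<in> borel_measurable M"
  by (simp add: measurable_restrict_space2_iff)

text \<open>The index set \<open>A\<close> is left free because independence needs it as small as
  the demands before \<open>t\<close>, while measurability on the whole path needs all of
  them.\<close>

lemma measurable_state_at:
  assumes f: "f \<in> policies L" and L: "1 \<le> L"
  shows "{1..<t} \<subseteq> A \<Longrightarrow> (\<lambda>d. state_at L f d t) \<in> measurable (\<Pi>\<^sub>M i\<in>A. borel) (state_space L)"
proof (induction t)
  case 0
  then show ?case by (auto simp: init_state_def state_space_def space_pair_measure space_PiM)
next
  case (Suc t)
  show ?case
  proof (cases "t = 0")
    case True
    then show ?thesis by (auto simp: init_state_def state_space_def space_pair_measure space_PiM)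
  next
    case False
    let ?S = "\<lambda>d. state_at L f d t"
    have S: "?S \<in> measurable (\<Pi>\<^sub>M i\<in>A. borel) (state_space L)"
      by (intro Suc.IH order_trans[OF _ Suc.prems]) auto
    have x: "(\<lambda>d. fst (?S d)) \<in> measurable (\<Pi>\<^sub>M i\<in>A. borel) (\<Pi>\<^sub>M i\<in>{1..L}. borel_nonneg)"
      using S unfolding state_space_def by (rule measurable_compose) simp
    have xi: "(\<lambda>d. fst (?S d) i) \<in> measurable (\<Pi>\<^sub>M i\<in>A. borel) borel_nonneg" if "i \<in> {1..L}" for i
      using measurable_compose[OF x measurable_component_singleton[OF that]] .
    have I: "(\<lambda>d. snd (?S d)) \<in> measurable (\<Pi>\<^sub>M i\<in>A. borel) borel_nonneg"
      using S unfolding state_space_def by (rule measurable_compose) simp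
    have g: "(\<lambda>d. f t (?S d)) \<in> measurable (\<Pi>\<^sub>M i\<in>A. borel) borel_nonneg"
      using f False by (intro measurable_compose[OF S]) (auto simp: policies_def)
    have d: "(\<lambda>d. d t) \<in> borel_measurable (\<Pi>\<^sub>M i\<in>A. (borel :: real measure))"
      using Suc.prems False by (intro measurable_component_singleton) auto
    note b = borel_measurable_borel_nonneg
    have 1: "(\<lambda>d. \<lambda>i\<in>{1..L}. if i < L then fst (?S d) (i + 1) else f t (?S d))
        \<in> measurable (\<Pi>\<^sub>M i\<in>A. borel) (\<Pi>\<^sub>M i\<in>{1..L}. borel_nonneg)"
    proof (rule measurable_restrict)
      fix i assume "i \<in> {1..L}"
      then show "(\<lambda>d. if i < L then fst (?S d) (i + 1) else f t (?S d))
          \<in> measurable (\<Pi>\<^sub>M i\<in>A. borel) borel_nonneg"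
        using xi[of "i + 1"] g by (cases "i < L") auto
    qed
    have "(\<lambda>d. max 0 (snd (?S d) + fst (?S d) 1 - d t)) \<in> borel_measurable (\<Pi>\<^sub>M i\<in>A. borel)"
      using b[OF I] b[OF xi[of 1]] L d by (intro borel_measurable_max borel_measurable_diff borel_measurable_add) auto
    then have 2: "(\<lambda>d. max 0 (snd (?S d) + fst (?S d) 1 - d t)) \<in> measurable (\<Pi>\<^sub>M i\<in>A. borel) borel_nonneg"
      by (intro measurable_restrict_space2) auto
    show ?thesis
      using False measurable_Pair[OF 1 2] by (simp add: next_state_def state_space_def)
  qed
qed

lemma measurable_stock:
  assumes "f \<in> policies L" "1 \<le> L" "{1..<t} \<subseteq> A"
  shows "(\<lambda>d. stock L f d t) \<in> borel_measurable (\<Pi>\<^sub>M i\<in>A. borel)"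
proof -
  have "(\<lambda>d. snd (state_at L f d t)) \<in> measurable (\<Pi>\<^sub>M i\<in>A. borel) borel_nonneg"
    using measurable_state_at[OF assms] unfolding state_space_def by (rule measurable_compose) simp
  then show ?thesis
    unfolding stock_def by (rule borel_measurable_borel_nonneg)
qed

text \<open>Policies are constrained only on the state space. That paths stay inside it is part of
  the measurability of \<open>state_at\<close>, and nonnegativity is read off from there.\<close>

lemma arrival_nonneg:
  assumes "f \<in> policies L" "1 \<le> L"
  shows "0 \<le> arrival L f d t"
proof -
  have "d \<in> space (\<Pi>\<^sub>M i\<in>UNIV. (borel :: real measure))" by (simp add: space_PiM)
  then have "state_at L f d t \<in> space (state_space L)"
    using measurable_space[OF measurable_state_at[OF assms, of t UNIV]] by simp
  then show ?thesis
    using assms(2) by (auto simp: state_space_def space_pair_measure space_PiM arrival_def PiE_iff mem_Times_iff)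
qed

text \<open>The delivery in period \<open>t\<close> was ordered in period \<open>t - L\<close>.\<close>

lemma arrival_cong:
  assumes "1 \<le> L" "\<And>s. 1 \<le> s \<Longrightarrow> s + L < t \<Longrightarrow> d s = d' s"
  shows "arrival L f d t = arrival L f d' t"
proof (cases "t \<le> L")
  case False
  have "state_at L f d (t - L) = state_at L f d' (t - L)"
    using assms(2) by (intro state_at_cong) auto
  then show ?thesis using arrival_order[of "t - L" L f] assms(1) False by simp
qed (use assms(1) in \<open>simp add: arrival_early\<close>)

lemma measurable_arrival:
  assumes f: "f \<in> policies L" and L: "1 \<le> L" and A: "{1..<t - L} \<subseteq> A"
  shows "(\<lambda>d. arrival L f d t) \<in> borel_measurable (\<Pi>\<^sub>M i\<in>A. borel)"
proof (cases "t \<le> L")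
  case False
  have "(\<lambda>d. f (t - L) (state_at L f d (t - L))) \<in> measurable (\<Pi>\<^sub>M i\<in>A. borel) borel_nonneg"
    using f False by (intro measurable_compose[OF measurable_state_at[OF f L A]]) (auto simp: policies_def)
  then have "(\<lambda>d. f (t - L) (state_at L f d (t - L))) \<in> borel_measurable (\<Pi>\<^sub>M i\<in>A. borel)"
    by (rule borel_measurable_borel_nonneg)
  then show ?thesis using arrival_order[of "t - L" L f] L False by simp
qed (use L in \<open>simp add: arrival_early\<close>)

lemma const_policy_in_policies: "0 \<le> r \<Longrightarrow> const_policy r \<in> policies L"
  by (simp add: policies_def const_policy_def space_restrict_space)

lemma arrival_const_policy:
  "1 \<le> L \<Longrightarrow> L < t \<Longrightarrow> arrival L (const_policy r) d t = r"
  using arrival_order[of "t - L" L "const_policy r" d] by (simp add: const_policy_def)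

lemma stock_restrict: "{1..<t} \<subseteq> A \<Longrightarrow> stock L f (restrict d A) t = stock L f d t"
  unfolding stock_def by (intro arg_cong[where f=snd] state_at_cong) auto

lemma arrival_restrict: "1 \<le> L \<Longrightarrow> {1..<t - L} \<subseteq> A \<Longrightarrow> arrival L f (restrict d A) t = arrival L f d t"
  by (rule arrival_cong) (auto simp: subset_eq less_diff_conv)

section \<open>Lower bounds for arbitrary policies\<close>

context exp_demand
begin

text \<open>The expected \<open>i\<close>-th coordinate of the subgradient: the probability that
  index \<open>i\<close> lies in the busy period in progress at time \<open>n\<close>.\<close>

definition age_prob :: "real \<Rightarrow> nat \<Rightarrow> nat \<Rightarrow> real" where
  "age_prob r n i = expectation (\<lambda>w. if n \<le> i + busy (\<lambda>j. r - D (Suc j) w) n then 1 else 0)"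

lemma age_prob_nonneg: "0 \<le> age_prob r n i"
  by (simp add: age_prob_def)

lemma busy_rv [measurable]: "1 \<le> s \<Longrightarrow> (\<lambda>w. busy (\<lambda>j. r - D (s + j) w) n) \<in> measurable M (count_space UNIV)"
  using D_measurable by (intro measurable_busy borel_measurable_diff) auto

lemma sum_age_prob: "(\<Sum>i<n. age_prob r n i) = mean_age r n"
proof -
  have [measurable]: "(\<lambda>w. busy (\<lambda>j. r - D (Suc j) w) n) \<in> measurable M (count_space UNIV)"
    using busy_rv[of 1] by simp
  have "mean_age r n = expectation (\<lambda>w. \<Sum>i<n. if n \<le> i + busy (\<lambda>j. r - D (Suc j) w) n then 1 else 0)"
    unfolding mean_age_def age_def by (subst busy_eq_sum) simp
  also have "\<dots> = (\<Sum>i<n. age_prob r n i)"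
    unfolding age_prob_def
    by (intro Bochner_Integration.integral_sum integrable_const_bound[of _ 1]) auto
  finally show ?thesis ..
qed

context
  fixes L :: nat and f :: policy
  assumes L: "1 \<le> L" and f: "f \<in> policies L"
begin

abbreviation "S \<equiv> \<lambda>w. stock L f (\<lambda>s. D s w)"
abbreviation "X \<equiv> \<lambda>w. arrival L f (\<lambda>s. D s w)"
abbreviation "U \<equiv> \<lambda>w. unmet L f (\<lambda>s. D s w)"

lemma path_measurable:
  assumes "F \<in> borel_measurable (\<Pi>\<^sub>M i\<in>{1..}. borel)" "\<And>d. F (restrict d {1..}) = F d"
  shows "(\<lambda>w. F (\<lambda>s. D s w)) \<in> borel_measurable M"
proof -
  have "(\<lambda>w. restrict (\<lambda>s. D s w) {1..}) \<in> measurable M (\<Pi>\<^sub>M i\<in>{1..}. borel)"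
    by (intro measurable_restrict D_measurable) simp
  from measurable_compose[OF this assms(1)] show ?thesis by (simp only: assms(2))
qed

lemma stock_rv [measurable]: "(\<lambda>w. S w t) \<in> borel_measurable M"
  by (rule path_measurable[of "\<lambda>d. stock L f d t"]) (auto intro!: measurable_stock f L stock_restrict)

lemma arrival_rv [measurable]: "(\<lambda>w. X w t) \<in> borel_measurable M"
  by (rule path_measurable[of "\<lambda>d. arrival L f d t"]) (auto intro!: measurable_arrival f L arrival_restrict)

lemma unmet_rv: "1 \<le> t \<Longrightarrow> (\<lambda>w. U w t) \<in> borel_measurable M"
  unfolding unmet_def using D_measurable by measurable

lemma period_cost_rv: "1 \<le> t \<Longrightarrow> (\<lambda>w. period_cost h p L f (\<lambda>s. D s w) t) \<in> borel_measurable M"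
  unfolding period_cost_eq using unmet_rv by measurable

text \<open>Stock plus delivery is determined by earlier demands, so conditionally on the past it
  acts as a constant order-up-to level facing a fresh demand.\<close>

lemma period_cost_ge_newsvendor:
  assumes t: "1 \<le> t" and hp: "0 < h" "0 < p"
  shows "ennreal (h / lam * ln (1 + p / h)) \<le> (\<integral>\<^sup>+w. ennreal (period_cost h p L f (\<lambda>s. D s w) t) \<partial>M)"
proof -
  let ?c = "\<lambda>(x, y). ennreal (h * max (x - y) 0 + p * max (- (x - y)) 0)"
  have "indep_var borel (\<lambda>w. S w t + X w t) borel (D t)"
  proof (rule indep_from_past[where A="{1..<t}" and F="\<lambda>d. stock L f d t + arrival L f d t"])
    show "(\<lambda>d. stock L f d t + arrival L f d t) \<in> borel_measurable (\<Pi>\<^sub>M i\<in>{1..<t}. borel)"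
      by (intro borel_measurable_add measurable_stock measurable_arrival f L) auto
    show "stock L f (restrict d {1..<t}) t + arrival L f (restrict d {1..<t}) t = stock L f d t + arrival L f d t" for d
      using stock_restrict[of t "{1..<t}"] arrival_restrict[OF L, of t "{1..<t}"] by auto
  qed (use t in auto)
  then have "(\<integral>\<^sup>+w. ?c (S w t + X w t, D t w) \<partial>M) = (\<integral>\<^sup>+w. \<integral>\<^sup>+w'. ?c (S w t + X w t, D t w') \<partial>M \<partial>M)"
    by (rule nn_integral_indep_var) measurable
  also have "\<dots> \<ge> (\<integral>\<^sup>+w. ennreal (h / lam * ln (1 + p / h)) \<partial>M)"
    using nn_integral_newsvendor[OF t _ hp] stock_nonneg[of L f] arrival_nonneg[OF f L]
    by (intro nn_integral_mono) auto
  finally show ?thesis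
    by (simp add: emeasure_space_1 period_cost_def stock_def arrival_def Let_def split_beta)
qed

section \<open>Policies whose expected costs are finite up to a horizon\<close>

context
  fixes h p :: real and T :: nat
  assumes h: "0 < h" and p: "0 < p"
    and fin: "\<And>t. 1 \<le> t \<Longrightarrow> t \<le> T \<Longrightarrow> (\<integral>\<^sup>+w. ennreal (period_cost h p L f (\<lambda>s. D s w) t) \<partial>M) < \<infinity>"
begin

lemma integrable_cost:
  assumes t: "1 \<le> t" "t \<le> T"
  shows "integrable M (\<lambda>w. period_cost h p L f (\<lambda>s. D s w) t)"
proof (rule integrableI_nonneg)
  show "AE w in M. 0 \<le> period_cost h p L f (\<lambda>s. D s w) t"
    using t h p stock_nonneg by (auto simp: period_cost_eq unmet_def)
qed (use period_cost_rv fin t in auto)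

lemma integrable_stock:
  assumes "1 \<le> t" "t \<le> Suc T"
  shows "integrable M (\<lambda>w. S w t)"
proof (cases "t = 1")
  case False
  define u where "u = t - 1"
  have u: "t = Suc u" "1 \<le> u" "u \<le> T" using False assms by (auto simp: u_def)
  show ?thesis
  proof (rule Bochner_Integration.integrable_bound)
    show "integrable M (\<lambda>w. period_cost h p L f (\<lambda>s. D s w) u / h)"
      using integrable_cost[OF u(2,3)] by simp
    show "AE w in M. norm (S w t) \<le> norm (period_cost h p L f (\<lambda>s. D s w) u / h)"
      using stock_nonneg[of L f _ t] u h p by (auto simp: period_cost_eq unmet_def field_simps)
  qed simp
qed (simp add: stock_1)

lemma integrable_unmet:
  assumes t: "1 \<le> t" "t \<le> T"
  shows "integrable M (\<lambda>w. U w t)"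
proof -
  have "U w t = (period_cost h p L f (\<lambda>s. D s w) t - h * S w (Suc t)) / p" for w
    using t p by (simp add: period_cost_eq)
  then show ?thesis using integrable_cost[OF t] integrable_stock[of "Suc t"] t by simp
qed

text \<open>Nothing is assumed about moments of the orders. Finite costs control stock and unmet
  demand, and conservation of stock passes this on to the deliveries.\<close>

lemma integrable_arrival:
  assumes t: "1 \<le> t" "t \<le> T"
  shows "integrable M (\<lambda>w. X w t)"
proof -
  have "X w t = S w (Suc t) - S w t - U w t + D t w" for w
    using t by (simp add: unmet_eq)
  then show ?thesis
    using integrable_unmet[OF t] integrable_stock[of "Suc t"] integrable_stock[of t] t integrable_D[of t] by simp
qed

lemma expectation_unmet:
  assumes t: "1 \<le> t" "t \<le> T"
  shows "expectation (\<lambda>w. U w t) = expectation (\<lambda>w. S w (Suc t)) - expectation (\<lambda>w. S w t)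
    - expectation (\<lambda>w. X w t) + 1 / lam"
  unfolding unmet_eq[OF t(1)]
  using integrable_arrival[OF t] integrable_stock[of "Suc t"] integrable_stock[of t] t
    integrable_D[of t] expectation_D[of t] by simp

text \<open>Conservation of stock telescopes from an empty start, and the final stock is
  nonnegative. Read backwards, this bounds the total deliveries from below in terms of lost
  sales.\<close>

lemma sum_unmet_ge:
  assumes "m \<le> T"
  shows "m / lam - (\<Sum>t=1..m. expectation (\<lambda>w. X w t)) \<le> (\<Sum>t=1..T. expectation (\<lambda>w. U w t))"
proof -
  have "(\<Sum>t=1..m. expectation (\<lambda>w. U w t)) = m / lam - (\<Sum>t=1..m. expectation (\<lambda>w. X w t))
      + expectation (\<lambda>w. S w (Suc m))"
    using assms
  proof (induction m)
    case (Suc m)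
    then show ?case by (simp add: expectation_unmet add_divide_distrib)
  qed (simp add: stock_1)
  moreover have "expectation (\<lambda>w. S w (Suc m)) \<ge> 0" by (simp add: stock_nonneg)
  moreover have "(\<Sum>t=1..m. expectation (\<lambda>w. U w t)) \<le> (\<Sum>t=1..T. expectation (\<lambda>w. U w t))"
    using assms by (intro sum_mono2) (auto simp: unmet_def)
  ultimately show ?thesis by linarith
qed

text \<open>
  The deliveries in the \<open>L\<close> periods from \<open>s\<close> on were ordered before \<open>s\<close>, hence are independent of
  the demands in these periods; the queue with constant input \<open>r\<close> supplies a subgradient.
\<close>

lemma expectation_stock_ge:
  assumes s: "1 \<le> s" "s + L \<le> Suc T" and r: "0 \<le> r"
  shows "mean_queue r L + (\<Sum>i<L. age_prob r L i * (expectation (\<lambda>w. X w (s + i)) - r))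
    \<le> expectation (\<lambda>w. S w (s + L))"
proof -
  let ?I = "\<lambda>i w. if L \<le> i + busy (\<lambda>j. r - D (s + j) w) L then 1 else 0 :: real"
  let ?Q = "\<lambda>w. waiting (\<lambda>i. r - D (s + i) w) L"
  have Dsj: "D (s + j) \<in> borel_measurable M" for j using s by (intro D_measurable) simp
  note [measurable] = busy_rv[OF s(1)]
  have iI: "integrable M (?I i)" for i
    by (intro integrable_const_bound[of _ 1]) auto
  have EI: "expectation (?I i) = age_prob r L i" for i
    unfolding age_prob_def
  proof (rule expectation_shift[where \<Psi>="\<lambda>z. if L \<le> i + busy z L then 1 else 0" and n=L])
    have [measurable]: "(\<lambda>d. busy (\<lambda>j. r - d j) L) \<in> measurable (\<Pi>\<^sub>M i\<in>{..<L}. borel) (count_space UNIV)"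
      by (intro measurable_busy borel_measurable_diff measurable_component_singleton) auto
    show "(\<lambda>d. if L \<le> i + busy (\<lambda>j. r - d j) L then 1 else 0 :: real) \<in> borel_measurable (\<Pi>\<^sub>M i\<in>{..<L}. borel)"
      by measurable
    fix z z' :: "nat \<Rightarrow> real" assume "\<And>i. i < L \<Longrightarrow> z i = z' i"
    then have "busy z L = busy z' L" using waiting_busy_cong by blast
    then show "(if L \<le> i + busy z L then 1 else 0 :: real) = (if L \<le> i + busy z' L then 1 else 0)" by simp
  qed (use s in \<open>auto simp: inj_on_def\<close>)
  have EQ: "expectation ?Q = mean_queue r L"
    unfolding mean_queue_def queue_def
  proof (rule expectation_shift[where n=L])
    show "(\<lambda>d. waiting (\<lambda>i. r - d i) L) \<in> borel_measurable (\<Pi>\<^sub>M i\<in>{..<L}. borel)"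
      by (intro measurable_waiting borel_measurable_diff measurable_component_singleton) auto
  qed (use s in \<open>auto simp: inj_on_def intro!: waiting_busy_cong[THEN conjunct1]\<close>)
  have iQ: "integrable M ?Q"
  proof (rule integrable_const_bound)
    have sS: "D (s + i) = D (Suc (s - 1 + i))" for i using s by simp
    have "AE w in M. \<forall>i. D (s + i) w \<ge> 0"
      using D_nonneg unfolding sS by eventually_elim blast
    then show "AE w in M. norm (?Q w) \<le> L * r"
      by eventually_elim (auto simp: r intro!: waiting_le)
  qed (intro measurable_waiting borel_measurable_diff borel_measurable_const Dsj)
  have IX: "integrable M (\<lambda>w. ?I i w * X w (s + i))"
    "expectation (\<lambda>w. ?I i w * X w (s + i)) = age_prob r L i * expectation (\<lambda>w. X w (s + i))" if i: "i < L" for i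
  proof -
    let ?G = "\<lambda>d. if L \<le> i + busy (\<lambda>j. r - d (s + j)) L then 1 else 0 :: real"
    have ind: "indep_var borel (?I i) borel (\<lambda>w. X w (s + i))"
    proof (rule indep_blocks[where A="{s..<s+L}" and B="{1..<s}" and F="?G" and G="\<lambda>d. arrival L f d (s + i)"])
      have [measurable]: "(\<lambda>d. busy (\<lambda>j. r - d (s + j)) L) \<in> measurable (\<Pi>\<^sub>M i\<in>{s..<s+L}. borel) (count_space UNIV)"
        by (intro measurable_busy borel_measurable_diff measurable_component_singleton) auto
      show "?G \<in> borel_measurable (\<Pi>\<^sub>M i\<in>{s..<s+L}. borel)" by measurable
      show "?G (restrict d {s..<s+L}) = ?G d" for d
      proof -
        have "busy (\<lambda>j. r - restrict d {s..<s+L} (s + j)) L = busy (\<lambda>j. r - d (s + j)) L"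
          by (intro waiting_busy_cong[THEN conjunct2]) simp
        then show ?thesis by simp
      qed
      show "(\<lambda>d. arrival L f d (s + i)) \<in> borel_measurable (\<Pi>\<^sub>M i\<in>{1..<s}. borel)"
        using i by (intro measurable_arrival f L) auto
      show "arrival L f (restrict d {1..<s}) (s + i) = arrival L f d (s + i)" for d
        using i by (intro arrival_restrict L) auto
    qed (use s in auto)
    have iX: "integrable M (\<lambda>w. X w (s + i))" using s i by (intro integrable_arrival) auto
    show "integrable M (\<lambda>w. ?I i w * X w (s + i))"
      by (rule indep_var_integrable[OF ind iI iX])
    show "expectation (\<lambda>w. ?I i w * X w (s + i)) = age_prob r L i * expectation (\<lambda>w. X w (s + i))"
      using indep_var_lebesgue_integral[OF ind iI iX] EI by simp
  qed
  have "mean_queue r L + (\<Sum>i<L. age_prob r L i * (expectation (\<lambda>w. X w (s + i)) - r))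
      = expectation ?Q + (\<Sum>i<L. expectation (\<lambda>w. ?I i w * X w (s + i) - r * ?I i w))"
    using IX iI EI EQ by (simp add: right_diff_distrib mult.commute)
  also have "\<dots> = expectation (\<lambda>w. ?Q w + (\<Sum>i<L. ?I i w * X w (s + i) - r * ?I i w))"
    using IX iI iQ by (subst Bochner_Integration.integral_add)
      (auto intro!: Bochner_Integration.integrable_sum Bochner_Integration.integrable_diff
        Bochner_Integration.integral_sum[symmetric] integrable_mult_right)
  also have "\<dots> \<le> expectation (\<lambda>w. S w (s + L))"
  proof (rule integral_mono)
    show "integrable M (\<lambda>w. ?Q w + (\<Sum>i<L. ?I i w * X w (s + i) - r * ?I i w))"
      using IX iI iQ
      by (intro Bochner_Integration.integrable_add Bochner_Integration.integrable_sum
          Bochner_Integration.integrable_diff integrable_mult_right) auto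
    show "integrable M (\<lambda>w. S w (s + L))" using s by (intro integrable_stock) auto
    fix w
    have "(\<Sum>i<L. ?I i w * X w (s + i) - r * ?I i w)
        = (\<Sum>i<L. if L \<le> i + busy (\<lambda>j. r - D (s + j) w) L then X w (s + i) - r else 0)"
      by (intro sum.cong) auto
    then show "?Q w + (\<Sum>i<L. ?I i w * X w (s + i) - r * ?I i w) \<le> S w (s + L)"
      using waiting_subgradient[of r "\<lambda>j. D (s + j) w" L "\<lambda>i. X w (s + i)"]
        waiting_le_stock[OF s(1), of L f "\<lambda>s. D s w" L] by simp
  qed
  finally show ?thesis .
qed

text \<open>Sum the window bound over all \<open>m\<close> starting periods. For each offset
  \<open>i\<close> the deliveries seen by the windows form one consecutive block, so their sum is at
  least m / lam minus all lost sales. The weights \<open>age_prob\<close> add up to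
  \<open>mean_age\<close>, which becomes the price of a lost unit in terms of stock.\<close>

lemma sum_cost_ge_finite:
  assumes m: "m + L = Suc T" and r: "0 \<le> r" and hQ: "h * mean_age r L \<le> p"
  shows "ennreal (m * (h * (mean_queue r L + mean_age r L * (1 / lam - r))))
    \<le> (\<Sum>t=1..T. \<integral>\<^sup>+w. ennreal (period_cost h p L f (\<lambda>s. D s w) t) \<partial>M)"
proof -
  let ?a = "\<lambda>t. expectation (\<lambda>w. X w t)"
  let ?U = "\<Sum>t=1..T. expectation (\<lambda>w. U w t)"
  let ?w = "age_prob r L"
  have U0: "0 \<le> ?U" by (intro sum_nonneg) (simp add: unmet_def)
  have "m * (mean_queue r L + mean_age r L * (1 / lam - r)) - mean_age r L * ?U
      = m * mean_queue r L + (\<Sum>i<L. ?w i * (m / lam - ?U - m * r))"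
    by (simp add: sum_distrib_right[symmetric] sum_age_prob) (simp add: algebra_simps)
  also have "\<dots> \<le> m * mean_queue r L + (\<Sum>i<L. ?w i * ((\<Sum>s=1..m. ?a (s + i)) - m * r))"
  proof (intro add_left_mono sum_mono mult_left_mono age_prob_nonneg)
    fix i assume i: "i \<in> {..<L}"
    have "(m + i) / lam - (\<Sum>t=1..m+i. ?a t) \<le> ?U"
      using sum_unmet_ge[of "m + i"] m i by auto
    \<comment> \<open>Since i < L, the deliveries in periods 1 to \<open>i\<close> are zero: nothing
      was ordered before period 1.\<close>
    moreover have "(\<Sum>t=1..m+i. ?a t) = (\<Sum>t=1+i..m+i. ?a t)"
      using i L by (intro sum.mono_neutral_right) (auto simp: arrival_early)
    moreover have "\<dots> = (\<Sum>s=1..m. ?a (s + i))"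
      by (rule sum.shift_bounds_cl_nat_ivl)
    moreover have "m / lam \<le> (m + i) / lam" using lam_pos by (simp add: divide_right_mono)
    ultimately show "m / lam - ?U - m * r \<le> (\<Sum>s=1..m. ?a (s + i)) - m * r" by linarith
  qed
  also have "\<dots> = (\<Sum>s=1..m. mean_queue r L + (\<Sum>i<L. ?w i * (?a (s + i) - r)))"
    by (simp add: sum.distrib right_diff_distrib sum_subtractf sum_distrib_left mult_ac)
       (rule sum.swap)
  also have "\<dots> \<le> (\<Sum>s=1..m. expectation (\<lambda>w. S w (s + L)))"
    using m r by (intro sum_mono expectation_stock_ge) auto
  also have "\<dots> = (\<Sum>t=L..T. expectation (\<lambda>w. S w (Suc t)))"
  proof -
    have "(\<Sum>s=1..m. expectation (\<lambda>w. S w (s + L))) = (\<Sum>t=1+L..m+L. expectation (\<lambda>w. S w t))"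
      by (rule sum.shift_bounds_cl_nat_ivl[symmetric])
    also have "\<dots> = (\<Sum>t=Suc L..Suc T. expectation (\<lambda>w. S w t))" using m by simp
    finally show ?thesis by (simp only: sum.shift_bounds_cl_Suc_ivl)
  qed
  also have "\<dots> \<le> (\<Sum>t=1..T. expectation (\<lambda>w. S w (Suc t)))"
    using L by (intro sum_mono2) (auto simp: stock_nonneg)
  finally have "m * (mean_queue r L + mean_age r L * (1 / lam - r)) \<le>
      (\<Sum>t=1..T. expectation (\<lambda>w. S w (Suc t))) + mean_age r L * ?U"
    by simp
  then have "h * (m * (mean_queue r L + mean_age r L * (1 / lam - r))) \<le>
      h * ((\<Sum>t=1..T. expectation (\<lambda>w. S w (Suc t))) + mean_age r L * ?U)"
    using h by (intro mult_left_mono) auto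
  \<comment> \<open>The penalty on a lost unit outweighs the holding cost that losing it can
    save.\<close>
  also have "\<dots> \<le> h * (\<Sum>t=1..T. expectation (\<lambda>w. S w (Suc t))) + p * ?U"
    using mult_right_mono[OF hQ U0] by (simp add: algebra_simps)
  also have "\<dots> = (\<Sum>t=1..T. expectation (\<lambda>w. period_cost h p L f (\<lambda>s. D s w) t))"
    using integrable_stock integrable_unmet
    by (simp add: sum_distrib_left sum.distrib[symmetric] period_cost_eq)
  finally have "ennreal (h * (m * (mean_queue r L + mean_age r L * (1 / lam - r)))) \<le>
      ennreal (\<Sum>t=1..T. expectation (\<lambda>w. period_cost h p L f (\<lambda>s. D s w) t))"
    by (rule ennreal_leI)
  also have "\<dots> = (\<Sum>t=1..T. ennreal (expectation (\<lambda>w. period_cost h p L f (\<lambda>s. D s w) t)))"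
    using h p stock_nonneg
    by (intro sum_ennreal[symmetric] integral_nonneg_AE) (auto simp: period_cost_eq unmet_def)
  also have "\<dots> = (\<Sum>t=1..T. \<integral>\<^sup>+w. ennreal (period_cost h p L f (\<lambda>s. D s w) t) \<partial>M)"
    using h p stock_nonneg integrable_cost
    by (intro sum.cong nn_integral_eq_integral[symmetric]) (auto simp: period_cost_eq unmet_def)
  finally show ?thesis by (simp add: mult_ac)
qed

end

text \<open>If some period has infinite expected cost, then so does the sum, and there is nothing to
  show.\<close>

lemma sum_cost_ge:
  assumes "0 < h" "0 < p" "m + L = Suc T" "0 \<le> r" "h * mean_age r L \<le> p"
  shows "ennreal (m * (h * (mean_queue r L + mean_age r L * (1 / lam - r))))
    \<le> (\<Sum>t=1..T. \<integral>\<^sup>+w. ennreal (period_cost h p L f (\<lambda>s. D s w) t) \<partial>M)"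
proof (cases "\<forall>t\<in>{1..T}. (\<integral>\<^sup>+w. ennreal (period_cost h p L f (\<lambda>s. D s w) t) \<partial>M) < \<infinity>")
  case True
  then show ?thesis using assms by (intro sum_cost_ge_finite) auto
next
  case False
  then obtain u where u: "u \<in> {1..T}" "(\<integral>\<^sup>+w. ennreal (period_cost h p L f (\<lambda>s. D s w) u) \<partial>M) = \<infinity>"
    by (auto simp: less_top[symmetric])
  then have "(\<Sum>t=1..T. \<integral>\<^sup>+w. ennreal (period_cost h p L f (\<lambda>s. D s w) t) \<partial>M) = \<infinity>"
    using member_le_sum[OF u(1), of "\<lambda>t. \<integral>\<^sup>+w. ennreal (period_cost h p L f (\<lambda>s. D s w) t) \<partial>M"]
    by (auto simp: top_unique)
  then show ?thesis by (simp only: infinity_ennreal_def top_greatest)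
qed

end

end

section \<open>Long-run averages\<close>

lemma cesaro_mean_tendsto:
  fixes a :: "nat \<Rightarrow> real"
  assumes a: "a \<longlonglongrightarrow> l"
  shows "(\<lambda>T. (\<Sum>t=1..T. a t) / T) \<longlonglongrightarrow> l"
proof (rule LIMSEQ_I)
  fix e :: real assume e: "0 < e"
  then obtain N where N: "\<And>t. t \<ge> N \<Longrightarrow> \<bar>a t - l\<bar> < e / 2"
    using LIMSEQ_D[OF a, of "e / 2"] by auto
  define C where "C = (\<Sum>t=1..N. \<bar>a t - l\<bar>)"
  have "\<bar>(\<Sum>t=1..T. a t) / T - l\<bar> < e" if T: "T \<ge> max (Suc N) (nat \<lceil>2 * C / e\<rceil> + 1)" for T
  proof -
    have T0: "0 < real T" "2 * C / e < real T" using T by linarith+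
    have "(\<Sum>t=1..T. a t) / T - l = (\<Sum>t=1..T. a t - l) / T"
      using T0 by (simp add: sum_subtractf field_simps)
    moreover have "\<bar>\<Sum>t=1..T. a t - l\<bar> \<le> (\<Sum>t=1..T. (if t \<le> N then \<bar>a t - l\<bar> else 0) + e / 2)"
      using N e by (intro order_trans[OF sum_abs] sum_mono) (auto simp: not_le less_imp_le)
    moreover have "\<dots> = C + T * (e / 2)"
      unfolding C_def sum.distrib using T by (auto simp: sum.If_cases intro!: sum.cong)
    ultimately have "\<bar>(\<Sum>t=1..T. a t) / T - l\<bar> \<le> (C + T * (e / 2)) / T"
      using T0 by (simp add: divide_right_mono)
    also have "\<dots> < e" using T0 e by (simp add: field_simps)
    finally show ?thesis .
  qed
  then show "\<exists>no. \<forall>n\<ge>no. norm ((\<Sum>t=1..n. a t) / n - l) < e" by auto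
qed

context exp_demand
begin

lemma avg_cost_ge:
  assumes L: "1 \<le> L" and f: "f \<in> policies L" and hp: "0 < h" "0 < p"
    and r: "0 \<le> r" and hQ: "h * mean_age r L \<le> p"
  shows "ennreal (h * (mean_queue r L + mean_age r L * (1 / lam - r))) \<le> avg_cost M D h p L f"
proof -
  define B where "B = h * (mean_queue r L + mean_age r L * (1 / lam - r))"
  show ?thesis
  proof (cases "0 \<le> B")
    case True
    \<comment> \<open>A horizon T >= L contains m = T + 1 - L windows of L periods, and the
      coefficient of \<open>B\<close> is m / T.\<close>
    have "(\<lambda>T. (1 + (1 - real L) * (1 / real T)) * B) \<longlonglongrightarrow> (1 + (1 - real L) * 0) * B"
      by (intro tendsto_intros lim_1_over_n)
    then have "(\<lambda>T. ennreal ((1 + (1 - real L) * (1 / real T)) * B)) \<longlonglongrightarrow> ennreal B"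
      by (intro tendsto_ennrealI) simp
    then have "ennreal B = limsup (\<lambda>T. ennreal ((1 + (1 - real L) * (1 / real T)) * B))"
      by (intro lim_imp_Limsup[symmetric]) auto
    also have "\<dots> \<le> avg_cost M D h p L f"
      unfolding avg_cost_def
    proof (rule Limsup_mono, rule eventually_sequentiallyI)
      fix T assume T: "L \<le> T"
      define m where "m = Suc T - L"
      have m: "m + L = Suc T" using T by (simp add: m_def)
      then have mr: "real m = real T + 1 - real L" by linarith
      have "ennreal ((1 + (1 - real L) * (1 / real T)) * B) = ennreal (m * B) / ennreal T"
        using T L mult_nonneg_nonneg[OF of_nat_0_le_iff True, of m]
        by (subst divide_ennreal) (auto simp: mr field_simps)
      also have "\<dots> \<le> (\<Sum>t=1..T. \<integral>\<^sup>+w. ennreal (period_cost h p L f (\<lambda>s. D s w) t) \<partial>M) / ennreal T"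
        unfolding B_def using sum_cost_ge[OF L f hp m r hQ] by (rule divide_right_mono_ennreal)
      finally show "ennreal ((1 + (1 - real L) * (1 / real T)) * B)
        \<le> (\<Sum>t=1..T. \<integral>\<^sup>+w. ennreal (period_cost h p L f (\<lambda>s. D s w) t) \<partial>M) / of_nat T"
        by (simp add: ennreal_of_nat_eq_real_of_nat)
    qed
    finally show ?thesis unfolding B_def .
  next
    case False
    then show ?thesis unfolding B_def by (simp add: ennreal_neg)
  qed
qed

lemma avg_cost_ge_newsvendor:
  assumes L: "1 \<le> L" and f: "f \<in> policies L" and hp: "0 < h" "0 < p"
  shows "ennreal (h / lam * ln (1 + p / h)) \<le> avg_cost M D h p L f"
proof -
  let ?N = "ennreal (h / lam * ln (1 + p / h))"
  have "?N = limsup (\<lambda>T::nat. ?N)" by (simp add: Limsup_const)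
  also have "\<dots> \<le> avg_cost M D h p L f"
    unfolding avg_cost_def
  proof (rule Limsup_mono, rule eventually_sequentiallyI)
    fix T :: nat assume T: "1 \<le> T"
    have "?N = (of_nat T * ?N) / of_nat T"
      using T by (subst mult.commute, subst ennreal_mult_divide_eq) (auto simp: ennreal_of_nat_eq_real_of_nat)
    also have "of_nat T * ?N = (\<Sum>t=1..T. ?N)" by simp
    also have "\<dots> / of_nat T \<le> (\<Sum>t=1..T. \<integral>\<^sup>+w. ennreal (period_cost h p L f (\<lambda>s. D s w) t) \<partial>M) / of_nat T"
      using period_cost_ge_newsvendor[OF L f _ hp] by (intro divide_right_mono_ennreal sum_mono) auto
    finally show "?N \<le> (\<Sum>t=1..T. \<integral>\<^sup>+w. ennreal (period_cost h p L f (\<lambda>s. D s w) t) \<partial>M) / of_nat T" .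
  qed
  finally show ?thesis .
qed

section \<open>Constant-order policies\<close>

lemma stock_const_policy_early:
  assumes L: "1 \<le> L" and d: "\<And>i. 0 \<le> d (Suc i)"
  shows "t < Suc L \<Longrightarrow> stock L (const_policy r) d (Suc t) = 0"
proof (induction t)
  case (Suc t)
  then show ?case using d[of t] L by (simp add: stock_Suc arrival_early)
qed (simp add: stock_1)

text \<open>Nothing arrives in the first L periods and demand is almost surely nonnegative, so the
  stock is 0 up to period L + 1. From then on it is the queue driven by demands shifted by L. The
  increments of its mean vanish in the limit, so the expected lost sales tend to 1 / lam -
  r.\<close>

lemma avg_cost_const_policy:
  assumes L: "1 \<le> L" and r: "0 \<le> r" "r < 1 / lam" and hp: "0 < h" "0 < p"
  shows "avg_cost M D h p L (const_policy r) = ennreal (h * stat_mean r + p * (1 / lam - r))"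
proof -
  let ?f = "const_policy r"
  let ?S = "\<lambda>t w. stock L ?f (\<lambda>s. D s w) t"
  let ?C = "\<lambda>t w. period_cost h p L ?f (\<lambda>s. D s w) t"
  let ?W = "\<lambda>n w. waiting (\<lambda>i. r - D (Suc L + i) w) n"
  have f: "?f \<in> policies L" using r by (intro const_policy_in_policies) simp
  have early: "AE w in M. ?S t w = 0" if "1 \<le> t" "t \<le> Suc L" for t
    using D_nonneg
  proof eventually_elim
    case (elim w)
    then show ?case
      using stock_const_policy_early[OF L, of "\<lambda>s. D s w" "t - 1" r] that by simp
  qed
  have late: "AE w in M. ?S (Suc L + n) w = ?W n w" for n
  proof -
    have "AE w in M. ?S (Suc L) w = 0" by (rule early) auto
    then show ?thesis
    proof eventually_elim
      case (elim w)
      then show ?case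
        using stock_eq_waiting[of "Suc L" L ?f "\<lambda>s. D s w" n] L by (simp add: arrival_const_policy)
    qed
  qed
  have Wm: "?W n \<in> borel_measurable M" for n
    by (intro measurable_waiting) simp
  have iW: "integrable M (?W n)" for n
  proof (rule integrable_const_bound[of _ "n * r"])
    show "AE w in M. norm (?W n w) \<le> n * r"
      using D_nonneg by eventually_elim (auto simp: r intro!: waiting_le)
  qed (rule Wm)
  have EW: "expectation (?W n) = mean_queue r n" for n
    unfolding mean_queue_def queue_def
  proof (rule expectation_shift[where n=n])
    show "(\<lambda>d. waiting (\<lambda>i. r - d i) n) \<in> borel_measurable (\<Pi>\<^sub>M i\<in>{..<n}. borel)"
      by (intro measurable_waiting borel_measurable_diff measurable_component_singleton) auto
  qed (auto simp: inj_on_def intro!: waiting_busy_cong[THEN conjunct1])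
  note [measurable] = stock_rv[OF L f]
  have iS: "integrable M (?S t)" if t: "1 \<le> t" for t
  proof (cases "t \<le> Suc L")
    case True
    then show ?thesis using integrable_cong_AE[of "?S t" M "\<lambda>_. 0"] early[OF t] by simp
  next
    case False
    have "integrable M (?S (Suc L + (t - Suc L)))"
      by (rule integrable_cong_AE_imp[OF iW stock_rv[OF L f]]) (use late[of "t - Suc L"] in \<open>auto elim: eventually_mono\<close>)
    then show ?thesis using False by simp
  qed
  have ES: "expectation (?S (Suc L + n)) = mean_queue r n" for n
    using integral_cong_AE[OF _ Wm late, of n] EW by simp
  have Ceq: "?C t w = h * ?S (Suc t) w + p * (?S (Suc t) w - ?S t w - arrival L ?f (\<lambda>s. D s w) t + D t w)"
    if "1 \<le> t" for t w
    using that by (simp add: period_cost_eq unmet_eq)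
  have iA: "integrable M (\<lambda>w. arrival L ?f (\<lambda>s. D s w) t)" for t
    using arrival_early[OF L, of t] arrival_const_policy[OF L, of t] by (cases "t \<le> L") auto
  have iC: "integrable M (?C t)" if "1 \<le> t" for t
    unfolding Ceq[OF that] using iS[of t] iS[of "Suc t"] iA integrable_D that by auto
  define e where "e t = expectation (?C t)" for t
  have C0: "0 \<le> ?C t w" if "1 \<le> t" for t w
    using that hp by (simp add: period_cost_eq stock_nonneg unmet_def)
  have nn: "(\<integral>\<^sup>+w. ennreal (?C t w) \<partial>M) = ennreal (e t)" if "1 \<le> t" for t
    unfolding e_def using iC[OF that] C0[OF that] by (intro nn_integral_eq_integral) auto
  have e0: "0 \<le> e t" if "1 \<le> t" for t
    unfolding e_def using C0[OF that] by simp
  have late_e: "e (n + Suc L) = h * mean_queue r (Suc n)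
      + p * (mean_queue r (Suc n) - mean_queue r n - r + 1 / lam)" for n
  proof -
    have "?C (n + Suc L) w = h * ?S (Suc L + Suc n) w + p * (?S (Suc L + Suc n) w - ?S (Suc L + n) w - r + D (Suc L + n) w)" for w
      using Ceq[of "n + Suc L" w] arrival_const_policy[OF L, of "n + Suc L"] by (simp add: add.commute)
    then show ?thesis
      unfolding e_def using iS[of "Suc L + Suc n"] iS[of "Suc L + n"] ES[of n] ES[of "Suc n"]
        integrable_D[of "Suc L + n"] expectation_D[of "Suc L + n"]
      by (simp add: prob_space)
  qed
  have "(\<lambda>n. e (n + Suc L)) \<longlonglongrightarrow> h * stat_mean r + p * (stat_mean r - stat_mean r - r + 1 / lam)"
    unfolding late_e using mean_queue_tendsto[OF r] LIMSEQ_Suc[OF mean_queue_tendsto[OF r]]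
    by (intro tendsto_intros)
  then have "(\<lambda>n. e (n + Suc L)) \<longlonglongrightarrow> h * stat_mean r + p * (1 / lam - r)" by simp
  then have "(\<lambda>T. ennreal ((\<Sum>t=1..T. e t) / T)) \<longlonglongrightarrow> ennreal (h * stat_mean r + p * (1 / lam - r))"
    by (intro tendsto_ennrealI cesaro_mean_tendsto LIMSEQ_offset[where f=e and k="Suc L"])
  moreover have "eventually (\<lambda>T. ennreal ((\<Sum>t=1..T. e t) / T)
      = (\<Sum>t=1..T. \<integral>\<^sup>+w. ennreal (?C t w) \<partial>M) / of_nat T) sequentially"
  proof (rule eventually_sequentiallyI)
    fix T :: nat assume T: "1 \<le> T"
    have "(\<Sum>t=1..T. \<integral>\<^sup>+w. ennreal (?C t w) \<partial>M) = ennreal (\<Sum>t=1..T. e t)"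
      using nn e0 by (subst sum_ennreal[symmetric]) (auto intro!: sum.cong)
    moreover have "0 \<le> (\<Sum>t=1..T. e t)" using e0 by (intro sum_nonneg) auto
    ultimately show "ennreal ((\<Sum>t=1..T. e t) / T) = (\<Sum>t=1..T. \<integral>\<^sup>+w. ennreal (?C t w) \<partial>M) / of_nat T"
      using T by (simp add: divide_ennreal ennreal_of_nat_eq_real_of_nat)
  qed
  ultimately have "(\<lambda>T. (\<Sum>t=1..T. \<integral>\<^sup>+w. ennreal (?C t w) \<partial>M) / of_nat T) \<longlonglongrightarrow> ennreal (h * stat_mean r + p * (1 / lam - r))"
    by (rule Lim_transform_eventually)
  then show ?thesis
    unfolding avg_cost_def by (intro lim_imp_Limsup) auto
qed

end

section \<open>The optimal rate and the gap to the optimum\<close>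

lemma tau_bounds:
  assumes "0 < h" "0 < p"
  shows "0 < tau p h" "tau p h < 1" "(h + 2 * p) * (tau p h)\<^sup>2 = h" "(h + 2 * p) * tau p h = sqrt (h * (2 * p + h))"
proof -
  show "0 < tau p h" "tau p h < 1" using assms by (auto simp: tau_def)
  \<comment> \<open>This is the stationarity condition for u = 1 - lam r in the constant-order cost,
    written without division.\<close>
  show *: "(h + 2 * p) * (tau p h)\<^sup>2 = h" using assms by (simp add: tau_def add.commute)
  have "((h + 2 * p) * tau p h)\<^sup>2 = (h + 2 * p) * ((h + 2 * p) * (tau p h)\<^sup>2)"
    by (simp add: power2_eq_square mult_ac)
  also have "\<dots> = h * (2 * p + h)" unfolding * by (simp add: algebra_simps)
  finally show "(h + 2 * p) * tau p h = sqrt (h * (2 * p + h))"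
    using assms \<open>0 < tau p h\<close> by (intro real_sqrt_unique[symmetric]) auto
qed

lemma gam_bounds:
  assumes "0 < h" "0 < p"
  shows "0 < gam p h" "gam p h < 1"
proof -
  show "0 < gam p h" using tau_bounds[OF assms] by (simp add: gam_def)
  have "1 - tau p h < exp (- tau p h)"
    using exp_minus_greater[of "tau p h"] tau_bounds[OF assms] by simp
  then have "(1 - tau p h) * exp (tau p h) < exp (- tau p h) * exp (tau p h)"
    by (intro mult_strict_right_mono) auto
  then show "gam p h < 1" by (simp add: gam_def exp_minus)
qed

context exp_demand
begin

text \<open>Completing the square locates the optimal rate \<open>(1 - tau) / lam\<close>.\<close>

lemma const_cost_square:
  assumes hp: "0 < h" "0 < p" and r: "r < 1 / lam"
  defines "u \<equiv> 1 - lam * r"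
  shows "h * stat_mean r + p * (1 / lam - r) = inverse lam * (sqrt (h * (2 * p + h)) - h)
    + (h + 2 * p) * (u - tau p h)\<^sup>2 / (2 * u * lam)"
proof -
  have u: "0 < u" using r lam_pos by (simp add: u_def field_simps)
  have r': "r = (1 - u) / lam" "1 / lam - r = u / lam" using lam_pos by (auto simp: u_def field_simps)
  have "h * stat_mean r + p * (1 / lam - r) = (h * (1 - u)\<^sup>2 + 2 * p * u\<^sup>2) / (2 * u * lam)"
    unfolding stat_mean_def r'(2) unfolding r'(1)
    using u lam_pos by (simp add: field_simps power2_eq_square)
  also have "h * (1 - u)\<^sup>2 + 2 * p * u\<^sup>2 = 2 * u * ((h + 2 * p) * tau p h - h) + (h + 2 * p) * (u - tau p h)\<^sup>2"
    using tau_bounds(3)[OF hp] by (simp add: power2_eq_square algebra_simps)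
  also have "\<dots> / (2 * u * lam) = inverse lam * ((h + 2 * p) * tau p h - h) + (h + 2 * p) * (u - tau p h)\<^sup>2 / (2 * u * lam)"
    using u lam_pos by (simp add: field_simps)
  finally show ?thesis unfolding tau_bounds(4)[OF hp] .
qed

text \<open>The completed square vanishes at one rate only, and the endpoint 1 / lam has infinite
  cost by convention. The set of minimisers is thus a singleton, and its infimum is that
  rate.\<close>

lemma r_inf_eq:
  assumes L: "1 \<le> L" and hp: "0 < h" "0 < p"
  shows "r_inf M D h p L = (1 - tau p h) / lam"
proof -
  let ?r = "(1 - tau p h) / lam" and ?c = "const_cost M D h p L"
  note tau = tau_bounds[OF hp]
  have E: "expectation (D (Suc 0)) = 1 / lam" by (rule expectation_D) simp
  have r: "0 \<le> ?r" "?r < 1 / lam" using tau lam_pos by (auto simp: divide_strict_right_mono)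
  have u: "1 - lam * ?r = tau p h" using lam_pos by simp
  have c: "?c x = ennreal (inverse lam * (sqrt (h * (2 * p + h)) - h)
      + (h + 2 * p) * (1 - lam * x - tau p h)\<^sup>2 / (2 * (1 - lam * x) * lam))" if "0 \<le> x" "x < 1 / lam" for x
    using that avg_cost_const_policy[OF L that hp] const_cost_square[OF hp that(2)] by (simp add: const_cost_def E)
  have c_pos: "0 \<le> inverse lam * (sqrt (h * (2 * p + h)) - h)"
  proof -
    have "sqrt (h * h) \<le> sqrt (h * (2 * p + h))" using hp by (intro real_sqrt_le_mono mult_left_mono) auto
    then show ?thesis using hp lam_pos by simp
  qed
  have cr: "?c ?r = ennreal (inverse lam * (sqrt (h * (2 * p + h)) - h))"
    using c[OF r] u by simp
  have less: "?c ?r < ?c x" if x: "x \<in> {0..1 / lam}" "x \<noteq> ?r" for x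
  proof (cases "x < 1 / lam")
    case True
    have "0 < 1 - lam * x" using True lam_pos by (simp add: field_simps)
    moreover have "1 - lam * x - tau p h \<noteq> 0" using x(2) lam_pos by (auto simp: field_simps)
    ultimately have "0 < (h + 2 * p) * (1 - lam * x - tau p h)\<^sup>2 / (2 * (1 - lam * x) * lam)"
      using hp lam_pos by (intro divide_pos_pos mult_pos_pos) auto
    then show ?thesis unfolding cr using c[of x] c_pos x True by (simp add: ennreal_less_iff)
  next
    case False
    then show ?thesis unfolding cr by (simp add: const_cost_def E)
  qed
  have "{x. is_arg_min ?c (\<lambda>x. x \<in> {0..1 / lam}) x} = {?r}"
  proof (intro set_eqI iffI)
    fix x assume "x \<in> {x. is_arg_min ?c (\<lambda>x. x \<in> {0..1 / lam}) x}"
    then show "x \<in> {?r}" using less[of x] r by (auto simp: is_arg_min_def)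
  next
    fix x assume "x \<in> {?r}"
    then show "x \<in> {x. is_arg_min ?c (\<lambda>x. x \<in> {0..1 / lam}) x}"
      using less r by (auto simp: is_arg_min_def) (metis less_asym atLeastAtMost_iff less_irrefl)
  qed
  then show ?thesis unfolding r_inf_def by (simp add: E)
qed

text \<open>The lower bound falls short of the constant-order cost in two places. The deficit of
  \<open>mean_age\<close> is multiplied by 1 / lam - r = \<open>tau p h\<close> / lam and gives the
  first summand of the prefactor. The deficit of \<open>mean_queue\<close> carries 1 / (e \<theta>
  (L + 1)), where lam / \<theta> is the inverse of \<open>tau p h\<close> minus 1, and gives the
  second.\<close>

lemma optimality_gap:
  assumes L: "1 \<le> L" and f: "f \<in> policies L" and hp: "0 < h" "0 < p"
  shows "ennreal (inverse lam * (sqrt (h * (2 * p + h)) - h)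
      - h / lam * ((tau p h + (inverse (tau p h) - 1) * inverse (exp 1 * (real L + 1)))
        * (gam p h ^ (L + 1) / (1 - gam p h)))) \<le> avg_cost M D h p L f"
proof -
  define t where "t = tau p h"
  define r where "r = (1 - t) / lam"
  \<comment> \<open>This equals 1 / r - lam, the minimiser of \<open>mgf r\<close>; the minimum is
    \<open>gam p h\<close>.\<close>
  define \<theta> where "\<theta> = lam * t / (1 - t)"
  note tau = tau_bounds[OF hp, folded t_def]
  have r: "0 < r" "r < 1 / lam" "1 / lam - r = t / lam"
    using tau lam_pos by (auto simp: r_def divide_strict_right_mono diff_divide_distrib)
  have \<theta>: "0 < \<theta>" using tau lam_pos by (simp add: \<theta>_def)
  have "\<theta> * r = t" "lam / (lam + \<theta>) = 1 - t"
    using tau lam_pos by (auto simp: \<theta>_def r_def field_simps)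
  then have mgf: "mgf r \<theta> = gam p h" by (simp add: mgf_def gam_def t_def)
  note g1 = gam_bounds(2)[OF hp]
  \<comment> \<open>Stationarity of the constant-order cost: the limiting mean age is p / h, so
    every finite one satisfies the condition of \<open>avg_cost_ge\<close>.\<close>
  have slope: "r * (2 / lam - r) / (2 * (1 / lam - r)\<^sup>2) = p / h"
  proof -
    have "2 / lam - r = (1 + t) / lam" by (simp add: r_def diff_divide_distrib add_divide_distrib)
    then have "r * (2 / lam - r) / (2 * (1 / lam - r)\<^sup>2) = (1 - t) * (1 + t) / (2 * t\<^sup>2)"
      unfolding r(3) using lam_pos tau by (simp add: r_def field_simps power2_eq_square)
    also have "\<dots> = p / h"
      using tau hp by (simp add: field_simps power2_eq_square)
    finally show ?thesis .
  qed
  define K where "K = gam p h ^ (L + 1) / (1 - gam p h)"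
  note age = mean_age_bounds[OF r(1,2) \<theta>, unfolded mgf, OF g1, of L, unfolded slope]
  have hQ: "h * mean_age r L \<le> p" using age(1) hp by (simp add: field_simps)
  have Q: "p - h * K \<le> h * mean_age r L"
    using mult_left_mono[OF age(2), of h] hp by (simp add: K_def algebra_simps)
  have "1 / (exp 1 * \<theta> * real (Suc L)) = (inverse t - 1) * inverse (exp 1 * (real L + 1)) / lam"
    using tau lam_pos by (simp add: \<theta>_def field_simps)
  then have G: "stat_mean r - (inverse t - 1) * inverse (exp 1 * (real L + 1)) / lam * K \<le> mean_queue r L"
    using stat_mean_le[OF _ r(2) \<theta>, of L, unfolded mgf, OF _ g1] r(1) by (simp add: K_def)
  define z where "z = (inverse t - 1) * inverse (exp 1 * (real L + 1))"
  have "1 - lam * r = t" using lam_pos by (simp add: r_def)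
  then have "inverse lam * (sqrt (h * (2 * p + h)) - h) = h * stat_mean r + p * (t / lam)"
    using const_cost_square[OF hp r(2)] r(3) by (simp add: t_def)
  then have "inverse lam * (sqrt (h * (2 * p + h)) - h) - h / lam * ((t + z) * K)
      = h * (stat_mean r - z / lam * K) + (p - h * K) * (t / lam)"
    by (simp add: algebra_simps add_divide_distrib diff_divide_distrib)
  also have "\<dots> \<le> h * mean_queue r L + h * mean_age r L * (t / lam)"
    using G[folded z_def] Q hp tau lam_pos by (intro add_mono mult_left_mono mult_right_mono) auto
  also have "\<dots> = h * (mean_queue r L + mean_age r L * (1 / lam - r))"
    unfolding r(3) by (simp add: algebra_simps)
  finally have "ennreal (inverse lam * (sqrt (h * (2 * p + h)) - h) - h / lam * ((t + z) * K)) \<le> ennreal \<dots>"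
    by (rule ennreal_leI)
  also have "\<dots> \<le> avg_cost M D h p L f"
    using r(1) by (intro avg_cost_ge[OF L f hp _ hQ]) simp
  finally show ?thesis unfolding K_def z_def t_def .
qed

end

theorem corollary1:
  fixes M :: "'w measure" and D :: "nat \<Rightarrow> 'w \<Rightarrow> real"
    and h p lam :: real and L :: nat
  assumes "prob_space M"
    and "h > 0" and "p > 0" and "lam > 0" and "L \<ge> 1"
    and "prob_space.indep_vars M (\<lambda>_. borel) D {1..}"
    and "\<And>t. t \<ge> 1 \<Longrightarrow> distributed M lborel (D t) (\<lambda>x. ennreal (exponential_density lam x))"
  shows "avg_cost M D h p L (const_policy (r_inf M D h p L))
           = ennreal (inverse lam * (sqrt (h * (2 * p + h)) - h))
       \<and> avg_cost M D h p L (const_policy (r_inf M D h p L)) / OPT M D h p L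
           \<le> ennreal (1 + (tau p h + (inverse (tau p h) - 1) * inverse (exp 1 * (real L + 1)))
                        * inverse ((1 - gam p h) * ln (1 + p * inverse h))
                        * gam p h ^ (L + 1))"
proof -
  interpret prob_space M by fact
  interpret exp_demand M D lam
    using assms by unfold_locales auto
  define t where "t = tau p h"
  define r where "r = (1 - t) / lam"
  define C where "C = inverse lam * (sqrt (h * (2 * p + h)) - h)"
  define A where "A = t + (inverse t - 1) * inverse (exp 1 * (real L + 1))"
  define K where "K = gam p h ^ (L + 1) / (1 - gam p h)"
  define N where "N = h / lam * ln (1 + p / h)"
  note tau = tau_bounds[OF assms(2,3), folded t_def]
  have r: "0 \<le> r" "r < 1 / lam"
    using tau lam_pos by (auto simp: r_def divide_strict_right_mono)
  have "1 - lam * r = t" using lam_pos by (simp add: r_def)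
  then have cost: "avg_cost M D h p L (const_policy r) = ennreal C"
    using avg_cost_const_policy[OF \<open>L \<ge> 1\<close> r assms(2,3)] const_cost_square[OF assms(2,3) r(2)]
    by (simp add: C_def t_def)
  have rinf: "r_inf M D h p L = r"
    using r_inf_eq[OF \<open>L \<ge> 1\<close> assms(2,3)] by (simp add: r_def t_def)
  have opt_le: "OPT M D h p L \<le> ennreal C"
    unfolding OPT_def cost[symmetric] by (intro INF_lower const_policy_in_policies r)
  \<comment> \<open>The optimum is finite because a constant-order policy is admissible, so the
    remaining argument takes place in the reals.\<close>
  then obtain c where c: "OPT M D h p L = ennreal c" "0 \<le> c"
    by (cases "OPT M D h p L") (auto simp: top_unique)
  have "ennreal N \<le> OPT M D h p L"
    unfolding OPT_def N_def using avg_cost_ge_newsvendor[OF \<open>L \<ge> 1\<close> _ assms(2,3)] by (intro INF_greatest)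
  then have No: "N \<le> c" using c by (simp add: ennreal_le_iff)
  have N0: "0 < N" using assms(2,3) lam_pos unfolding N_def by (intro mult_pos_pos divide_pos_pos ln_gt_zero) auto
  have "ennreal (C - h / lam * (A * K)) \<le> OPT M D h p L"
    unfolding OPT_def C_def A_def K_def t_def
    using optimality_gap[OF \<open>L \<ge> 1\<close> _ assms(2,3)] by (intro INF_greatest)
  then have gap: "C - h / lam * (A * K) \<le> c" using c by (auto simp: ennreal_le_iff2)
  note g = gam_bounds[OF assms(2,3)]
  have AK: "0 \<le> h / lam * (A * K)"
    using tau g assms lam_pos by (auto simp: A_def K_def field_simps intro!: mult_nonneg_nonneg add_nonneg_nonneg)
  have "C / c \<le> 1 + h / lam * (A * K) / c"
    using gap N0 No by (simp add: field_simps)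
  \<comment> \<open>The newsvendor bound replaces the unknown optimum in the denominator; its factor
    \<open>h / lam\<close> then cancels against that of the gap.\<close>
  also have "\<dots> \<le> 1 + h / lam * (A * K) / N"
    using AK N0 No by (intro add_left_mono divide_left_mono) auto
  also have "\<dots> = 1 + A * inverse ((1 - gam p h) * ln (1 + p * inverse h)) * gam p h ^ (L + 1)"
  proof -
    have "h / lam * (A * K) / N = A * K / ln (1 + p / h)"
      using assms(2) lam_pos by (simp add: N_def)
    then show ?thesis by (simp add: K_def divide_inverse mult_ac)
  qed
  finally have "ennreal (C / c) \<le> ennreal \<dots>" by (rule ennreal_leI)
  moreover have "0 \<le> C"
    using opt_le c N0 No by (cases "0 \<le> C") (auto simp: ennreal_neg)
  moreover have "ennreal C / ennreal c = ennreal (C / c)"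
    using N0 No \<open>0 \<le> C\<close> by (intro divide_ennreal) auto
  ultimately show ?thesis
    unfolding rinf cost c(1) C_def[symmetric] t_def[symmetric] A_def[symmetric] by simp
qed

end
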